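(* Let $O$ be a coordinate chart with fixed coordinates $x^\mu$ on an $n$-dimensional smooth manifold, let $H$ be a deformation, and let $\Gamma^H_T$ be the associated deformed group of diffeomorphisms of $O$, with multiplication function $\varphi$, action $f$, auxiliary functions $h(x)^\mu_m$, $\lambda(x,t)^m{}_n$, $\mu(x,t)^m{}_n$, and functions $\gamma^m{}_{kn}$, $F^m_{kn}$, $R^m{}_{lkn}$ (all as defined in the context). Then: (1) By its action on $O$, the group $\Gamma^H_T$ specifies a field of affine vielbeins (a smooth frame field of the tangent bundle of $O$), namely $X_m=h(x)^\mu_m\partial_\mu$, and a torsion-free affine connection $\nabla$ in the tangent bundle over $O$, namely the one determined by the infinitesimal form, to first order in $t$, of the parallel transport rule $\tau^m_\|(x)=\lambda(x,t(x))^m{}_n\,\tau^n(x')$, $x'=f(x,t(x))$, for vector fields $\tau=\tau^mX_m$, that is, $\tau^m_\|(x)=\tau^m(x)+t^n(x)\nabla_n\tau^m(x)$ with $\nabla_n\tau^m=X_n\tau^m+\gamma^m{}_{nk}\tau^k$. (2) The geometric characteristics of $O$ with this structure are defined by the multiplication law of $\Gamma^H_T$ (which is itself defined by $H$): the functions $F^m_{kl}$ give the anholonomity object of the frame, i.e. $[X_k,X_l]=F^m_{kl}X_m$; the functions $\gamma^m{}_{nk}$ are the coefficients of $\nabla$ in the frame $(X_m)$, i.e. $\nabla_{X_n}X_k=\gamma^m{}_{nk}X_m$; and the functions $R^m{}_{lkn}$ are the components of the curvature tensor of $\nabla$ in the frame $(X_m)$, i.e. $\nabla_{X_k}\nabla_{X_n}X_l-\nabla_{X_n}\nabla_{X_k}X_l-\nabla_{[X_k,X_n]}X_l=R^m{}_{lkn}X_m$.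 (3) Every torsion-free affine connection over $O$ can be specified in this way by some deformed group $\Gamma^H_T$.
   Context: All considerations are local: $O$ is a single coordinate chart, identified with an open subset of $\mathbb R^n$; "group" means local group, and formulas are understood wherever the points involved remain in $O$ (for sufficiently small parameters). Summation over repeated indices is understood; Greek indices are coordinate indices, Latin indices are frame/parameter indices; $\partial_\mu=\partial/\partial x^\mu$ and $\partial_m=\partial/\partial t^m$. $T=\mathbb R^n$ is the translation group. The undeformed group $\Gamma_T$ consists of smooth maps $\tilde t:O\to T$ with $\det(\delta^\mu_\nu+\partial_\nu\tilde t^\mu(x))\neq 0$ for all $x\in O$, acting on $O$ by $x'^\mu=x^\mu+\tilde t^\mu(x)$, with multiplication $(\tilde t\times\tilde t')^\mu(x)=\tilde t^\mu(x)+\tilde t'^\mu(x')$. A deformation is a map $H:O\times T\to T$ such that (1H) $H$ is smooth; (2H) $H(x,0)=0$ for all $x\in O$; (3H) there is a smooth map $K:O\times T\to T$ with $K(x,H(x,\tilde t))=\tilde t$ for all $x\in O$, $\tilde t\in T$. The deformed group $\Gamma^H_T=\{t(x)\}$ is the image of $\Gamma_T$ under the isomorphism $t^m(x)=H^m(x,\tilde t(x))$. It acts on $O$ by $x'^\mu=f^\mu(x,t(x))$, where $f^\mu(x,t):=x^\mu+K^\mu(x,t)$, and its multiplication is $(t*t')^m(x)=\varphi^m(x,t(x),t'(x'))$ with $x'=f(x,t(x))$, where for parameters $t,t'\in T$ $$\varphi^m(x,t,t'):=H^m\bigl(x,\,K(x,t)+K(f(x,t),t')\bigr).$$ Auxiliary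 functions: $h(x)^m_\mu:=\partial H^m(x,\tilde t)/\partial\tilde t^\mu|_{\tilde t=0}$ (an invertible matrix for each $x$, by (3H)), with inverse matrix $h(x)^\mu_m=\partial_mK^\mu(x,t)|_{t=0}$; $$\mu(x,t)^m{}_n:=\frac{\partial\varphi^m(x,t',t)}{\partial t'^n}\Big|_{t'=0},\qquad \lambda(x,t)^m{}_n:=\frac{\partial\varphi^m(x,t,t')}{\partial t'^n}\Big|_{t'=0}.$$ The functions $\gamma^m{}_{kn}(x)$ and $\rho^m{}_{lkn}(x)$ (with $\rho^m{}_{lkn}=\rho^m{}_{kln}$) are defined by the expansions up to second order in $t$ $$\mu(x,t)^m{}_n=\delta^m_n+\gamma^m{}_{nk}t^k+\tfrac12\rho^m{}_{lkn}t^lt^k+\cdots,\qquad \lambda(x,t)^m{}_n=\delta^m_n+\gamma^m{}_{kn}t^k+\cdots,$$ i.e. $\gamma^m{}_{kn}=\partial^2\varphi^m(x,t,t')/\partial t^k\partial t'^n|_{t=t'=0}$. The structure functions are $F^m_{kn}:=\gamma^m{}_{kn}-\gamma^m{}_{nk}$, and the left curvature tensor of $\Gamma^H_T$ is $R^m{}_{lkn}:=\rho^m{}_{lkn}-\rho^m{}_{lnk}$. *)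

theory Defs
  imports "HOL-Analysis.Analysis"
begin

text \<open>
  The chart \<open>O\<close> is an open set \<open>U\<close> of \<open>real ^ 'n\<close>; the translation group \<open>T\<close> is \<open>real ^ 'n\<close>.
  Functions on \<open>U\<close> are total functions whose values outside \<open>U\<close> are irrelevant.
  For a matrix \<open>A\<close>, the entry \<open>A $ i $ j\<close> has upper index \<open>i\<close> and lower index \<open>j\<close> when \<open>A\<close> is
  one of \<open>h(x)\<^sup>m\<^sub>\<mu>\<close>, \<open>h(x)\<^sup>\<mu>\<^sub>m\<close>, \<open>\<lambda>\<^sup>m\<^sub>n\<close>, \<open>\<mu>\<^sup>m\<^sub>n\<close>, and
  \<open>jacobian F (at t) $ m $ n = \<partial>F\<^sup>m/\<partial>t\<^sup>n\<close>.
\<close>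

subsection \<open>Smooth maps\<close>

primrec Ck_on ::
  "nat \<Rightarrow> 'a::real_normed_vector set \<Rightarrow> ('a \<Rightarrow> 'b::real_normed_vector) \<Rightarrow> bool" where
  "Ck_on 0 S f \<longleftrightarrow> continuous_on S f"
| "Ck_on (Suc k) S f \<longleftrightarrow>
     (\<forall>x\<in>S. f differentiable (at x)) \<and> (\<forall>v. Ck_on k S (\<lambda>x. frechet_derivative f (at x) v))"

text \<open>Only used for open \<open>S\<close>.\<close>

definition smooth_on :: "'a::real_normed_vector set \<Rightarrow> ('a \<Rightarrow> 'b::real_normed_vector) \<Rightarrow> bool" where
  "smooth_on S f \<longleftrightarrow> (\<forall>k. Ck_on k S f)"

subsection \<open>Vector fields and affine connections on an open set\<close>

type_synonym 'n vfield = "real ^ 'n \<Rightarrow> real ^ 'n"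

definition lie_bracket :: "('n::finite) vfield \<Rightarrow> 'n vfield \<Rightarrow> 'n vfield" where
  "lie_bracket X Y p = frechet_derivative Y (at p) (X p) - frechet_derivative X (at p) (Y p)"

definition frame_field :: "(real ^ 'n::finite) set \<Rightarrow> ('n \<Rightarrow> 'n vfield) \<Rightarrow> bool" where
  "frame_field U E \<longleftrightarrow>
     (\<forall>m. smooth_on U (E m)) \<and>
     (\<forall>x\<in>U. inj (\<lambda>m. E m x) \<and> independent (range (\<lambda>m. E m x)) \<and> span (range (\<lambda>m. E m x)) = UNIV)"

text \<open>
  A connection \<open>\<nabla>\<^sub>X Y = D X Y\<close> is only constrained on smooth fields. That \<open>D X Y\<close> on \<open>U\<close> depends
  only on the values of \<open>X\<close> and \<open>Y\<close> on \<open>U\<close> follows from the axioms, taking for \<open>g\<close> the indicator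
  function of the complement of \<open>U\<close>, which is smooth on the open set \<open>U\<close>.
\<close>

definition affine_connection ::
  "(real ^ 'n::finite) set \<Rightarrow> ('n vfield \<Rightarrow> 'n vfield \<Rightarrow> 'n vfield) \<Rightarrow> bool" where
  "affine_connection U D \<longleftrightarrow>
     (\<forall>X Y. smooth_on U X \<longrightarrow> smooth_on U Y \<longrightarrow> smooth_on U (D X Y)) \<and>
     (\<forall>X X' Y. smooth_on U X \<longrightarrow> smooth_on U X' \<longrightarrow> smooth_on U Y \<longrightarrow>
        (\<forall>x\<in>U. D (\<lambda>p. X p + X' p) Y x = D X Y x + D X' Y x)) \<and>
     (\<forall>(g :: real ^ 'n \<Rightarrow> real) X Y. smooth_on U g \<longrightarrow> smooth_on U X \<longrightarrow> smooth_on U Y \<longrightarrow>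
        (\<forall>x\<in>U. D (\<lambda>p. g p *\<^sub>R X p) Y x = g x *\<^sub>R D X Y x)) \<and>
     (\<forall>X Y Y'. smooth_on U X \<longrightarrow> smooth_on U Y \<longrightarrow> smooth_on U Y' \<longrightarrow>
        (\<forall>x\<in>U. D X (\<lambda>p. Y p + Y' p) x = D X Y x + D X Y' x)) \<and>
     (\<forall>(g :: real ^ 'n \<Rightarrow> real) X Y. smooth_on U g \<longrightarrow> smooth_on U X \<longrightarrow> smooth_on U Y \<longrightarrow>
        (\<forall>x\<in>U. D X (\<lambda>p. g p *\<^sub>R Y p) x
                = frechet_derivative g (at x) (X x) *\<^sub>R Y x + g x *\<^sub>R D X Y x))"

definition torsion_free ::
  "(real ^ 'n::finite) set \<Rightarrow> ('n vfield \<Rightarrow> 'n vfield \<Rightarrow> 'n vfield) \<Rightarrow> bool" where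
  "torsion_free U D \<longleftrightarrow>
     (\<forall>X Y. smooth_on U X \<longrightarrow> smooth_on U Y \<longrightarrow>
        (\<forall>x\<in>U. D X Y x - D Y X x - lie_bracket X Y x = 0))"

definition curvature ::
  "(('n::finite) vfield \<Rightarrow> 'n vfield \<Rightarrow> 'n vfield) \<Rightarrow> 'n vfield \<Rightarrow> 'n vfield \<Rightarrow> 'n vfield \<Rightarrow> 'n vfield"
where
  "curvature D X Y Z p = D X (D Y Z) p - D Y (D X Z) p - D (lie_bracket X Y) Z p"

subsection \<open>Deformations and the deformed group\<close>

definition deformation_inverse ::
  "(real ^ 'n::finite) set \<Rightarrow> (real ^ 'n \<Rightarrow> real ^ 'n \<Rightarrow> real ^ 'n) \<Rightarrow>
   (real ^ 'n \<Rightarrow> real ^ 'n \<Rightarrow> real ^ 'n) \<Rightarrow> bool" where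
  "deformation_inverse U H K \<longleftrightarrow>
     smooth_on (U \<times> UNIV) (\<lambda>(x, t). K x t) \<and> (\<forall>x\<in>U. \<forall>s. K x (H x s) = s)"

definition deformation ::
  "(real ^ 'n::finite) set \<Rightarrow> (real ^ 'n \<Rightarrow> real ^ 'n \<Rightarrow> real ^ 'n) \<Rightarrow> bool" where
  "deformation U H \<longleftrightarrow>
     smooth_on (U \<times> UNIV) (\<lambda>(x, s). H x s) \<and> (\<forall>x\<in>U. H x 0 = 0) \<and> (\<exists>K. deformation_inverse U H K)"

definition undeformed_group :: "(real ^ 'n::finite) set \<Rightarrow> (real ^ 'n \<Rightarrow> real ^ 'n) set" where
  "undeformed_group U =
     {s. smooth_on U s \<and> (\<forall>x\<in>U. det (mat 1 + jacobian s (at x)) \<noteq> 0)}"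

definition undeformed_mult ::
  "(real ^ 'n \<Rightarrow> real ^ 'n) \<Rightarrow> (real ^ 'n \<Rightarrow> real ^ 'n) \<Rightarrow> real ^ 'n \<Rightarrow> real ^ 'n" where
  "undeformed_mult s s' x = s x + s' (x + s x)"

definition deform ::
  "(real ^ 'n \<Rightarrow> real ^ 'n \<Rightarrow> real ^ 'n) \<Rightarrow> (real ^ 'n \<Rightarrow> real ^ 'n) \<Rightarrow> real ^ 'n \<Rightarrow> real ^ 'n" where
  "deform H s = (\<lambda>x. H x (s x))"

definition deformed_group ::
  "(real ^ 'n::finite) set \<Rightarrow> (real ^ 'n \<Rightarrow> real ^ 'n \<Rightarrow> real ^ 'n) \<Rightarrow> (real ^ 'n \<Rightarrow> real ^ 'n) set" where
  "deformed_group U H = deform H ` undeformed_group U"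

text \<open>The functions \<open>f\<close> and \<open>\<phi>\<close>. The latter depends on \<open>H\<close> and \<open>K\<close>, and everything below that is
  taken from the multiplication law has \<open>\<phi>\<close> as its only argument.\<close>

definition act_fun ::
  "(real ^ 'n \<Rightarrow> real ^ 'n \<Rightarrow> real ^ 'n) \<Rightarrow> real ^ 'n \<Rightarrow> real ^ 'n \<Rightarrow> real ^ 'n" where
  "act_fun K x t = x + K x t"

definition mult_fun ::
  "(real ^ 'n \<Rightarrow> real ^ 'n \<Rightarrow> real ^ 'n) \<Rightarrow> (real ^ 'n \<Rightarrow> real ^ 'n \<Rightarrow> real ^ 'n) \<Rightarrow>
   real ^ 'n \<Rightarrow> real ^ 'n \<Rightarrow> real ^ 'n \<Rightarrow> real ^ 'n" where
  "mult_fun H K x t t' = H x (K x t + K (act_fun K x t) t')"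

definition deformed_mult ::
  "(real ^ 'n \<Rightarrow> real ^ 'n \<Rightarrow> real ^ 'n) \<Rightarrow> (real ^ 'n \<Rightarrow> real ^ 'n \<Rightarrow> real ^ 'n) \<Rightarrow>
   (real ^ 'n \<Rightarrow> real ^ 'n) \<Rightarrow> (real ^ 'n \<Rightarrow> real ^ 'n) \<Rightarrow> real ^ 'n \<Rightarrow> real ^ 'n" where
  "deformed_mult H K t t' x = mult_fun H K x (t x) (t' (act_fun K x (t x)))"

subsection \<open>Auxiliary functions\<close>

definition h_mat :: "(real ^ 'n::finite \<Rightarrow> real ^ 'n \<Rightarrow> real ^ 'n) \<Rightarrow> real ^ 'n \<Rightarrow> real ^ 'n ^ 'n" where
  "h_mat H x = jacobian (H x) (at 0)"

text \<open>The vielbein \<open>X\<^sub>m = h(x)\<^sup>\<mu>\<^sub>m \<partial>\<^sub>\<mu>\<close>: column \<open>m\<close> of the inverse of \<open>h(x)\<^sup>m\<^sub>\<mu>\<close>.\<close>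

definition vielbein :: "(real ^ 'n::finite \<Rightarrow> real ^ 'n \<Rightarrow> real ^ 'n) \<Rightarrow> 'n \<Rightarrow> 'n vfield" where
  "vielbein H m x = column m (matrix_inv (h_mat H x))"

definition field_of_comps ::
  "(real ^ 'n::finite \<Rightarrow> real ^ 'n \<Rightarrow> real ^ 'n) \<Rightarrow> (real ^ 'n \<Rightarrow> real ^ 'n) \<Rightarrow> 'n vfield" where
  "field_of_comps H \<tau> x = (\<Sum>m\<in>UNIV. \<tau> x $ m *\<^sub>R vielbein H m x)"

type_synonym 'n mult_law = "real ^ 'n \<Rightarrow> real ^ 'n \<Rightarrow> real ^ 'n \<Rightarrow> real ^ 'n"

definition mu_mat :: "('n::finite) mult_law \<Rightarrow> real ^ 'n \<Rightarrow> real ^ 'n \<Rightarrow> real ^ 'n ^ 'n" where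
  "mu_mat \<phi> x t = jacobian (\<lambda>t'. \<phi> x t' t) (at 0)"

definition lambda_mat :: "('n::finite) mult_law \<Rightarrow> real ^ 'n \<Rightarrow> real ^ 'n \<Rightarrow> real ^ 'n ^ 'n" where
  "lambda_mat \<phi> x t = jacobian (\<lambda>t'. \<phi> x t t') (at 0)"

definition partial_at :: "'n::finite \<Rightarrow> (real ^ 'n \<Rightarrow> real) \<Rightarrow> real ^ 'n \<Rightarrow> real" where
  "partial_at k F t = frechet_derivative F (at t) (axis k 1)"

text \<open>
  \<open>gamma_coeff \<phi> x m k n\<close> is \<open>\<gamma>\<^sup>m\<^sub>k\<^sub>n(x) = \<partial>\<^sup>2\<phi>\<^sup>m(x,t,t')/\<partial>t\<^sup>k\<partial>t'\<^sup>n\<close> at \<open>t = t' = 0\<close>, the first-order Taylor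
  coefficient in \<open>t\<close> of \<open>\<lambda>(x,t)\<^sup>m\<^sub>n\<close>; \<open>rho_coeff \<phi> x m l k n\<close> is the coefficient \<open>\<rho>\<^sup>m\<^sub>l\<^sub>k\<^sub>n(x)\<close> of
  \<open>t\<^sup>l t\<^sup>k / 2\<close> in the Taylor expansion of \<open>\<mu>(x,t)\<^sup>m\<^sub>n\<close>.
\<close>

definition gamma_coeff :: "('n::finite) mult_law \<Rightarrow> real ^ 'n \<Rightarrow> 'n \<Rightarrow> 'n \<Rightarrow> 'n \<Rightarrow> real" where
  "gamma_coeff \<phi> x m k n = partial_at k (\<lambda>t. lambda_mat \<phi> x t $ m $ n) 0"

definition rho_coeff :: "('n::finite) mult_law \<Rightarrow> real ^ 'n \<Rightarrow> 'n \<Rightarrow> 'n \<Rightarrow> 'n \<Rightarrow> 'n \<Rightarrow> real" where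
  "rho_coeff \<phi> x m l k n = partial_at l (partial_at k (\<lambda>t. mu_mat \<phi> x t $ m $ n)) 0"

definition structure_fun :: "('n::finite) mult_law \<Rightarrow> real ^ 'n \<Rightarrow> 'n \<Rightarrow> 'n \<Rightarrow> 'n \<Rightarrow> real" where
  "structure_fun \<phi> x m k n = gamma_coeff \<phi> x m k n - gamma_coeff \<phi> x m n k"

definition left_curvature :: "('n::finite) mult_law \<Rightarrow> real ^ 'n \<Rightarrow> 'n \<Rightarrow> 'n \<Rightarrow> 'n \<Rightarrow> 'n \<Rightarrow> real" where
  "left_curvature \<phi> x m l k n = rho_coeff \<phi> x m l k n - rho_coeff \<phi> x m l n k"

text \<open>The components \<open>\<nabla>\<^sub>n\<tau>\<^sup>m = X\<^sub>n\<tau>\<^sup>m + \<gamma>\<^sup>m\<^sub>n\<^sub>k \<tau>\<^sup>k\<close> as a function of \<open>n\<close> and \<open>x\<close>.\<close>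

definition cov_deriv ::
  "(real ^ 'n::finite \<Rightarrow> real ^ 'n \<Rightarrow> real ^ 'n) \<Rightarrow> ('n::finite) mult_law \<Rightarrow> (real ^ 'n \<Rightarrow> real ^ 'n) \<Rightarrow>
   'n \<Rightarrow> real ^ 'n \<Rightarrow> real ^ 'n" where
  "cov_deriv H \<phi> \<tau> n x =
     (\<chi> m. frechet_derivative (\<lambda>p. \<tau> p $ m) (at x) (vielbein H n x)
            + (\<Sum>k\<in>UNIV. gamma_coeff \<phi> x m n k * \<tau> x $ k))"

subsection \<open>Infinitesimal action and parallel transport\<close>

text \<open>\<open>x' = f(x,t(x)) = x + t\<^sup>m(x) E\<^sub>m(x)\<close> to first order in \<open>t(x)\<close>, for group elements \<open>t\<close>.\<close>

definition infinitesimal_action ::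
  "(real ^ 'n::finite) set \<Rightarrow> (real ^ 'n \<Rightarrow> real ^ 'n \<Rightarrow> real ^ 'n) \<Rightarrow>
   (real ^ 'n \<Rightarrow> real ^ 'n \<Rightarrow> real ^ 'n) \<Rightarrow> ('n \<Rightarrow> 'n vfield) \<Rightarrow> bool" where
  "infinitesimal_action U H K E \<longleftrightarrow>
     (\<forall>x\<in>U. \<forall>e>0. \<exists>d>0. \<forall>t\<in>deformed_group U H. norm (t x) < d \<longrightarrow>
        norm (act_fun K x (t x) - x - (\<Sum>m\<in>UNIV. t x $ m *\<^sub>R E m x)) \<le> e * norm (t x))"

definition parallel_transport ::
  "(real ^ 'n::finite \<Rightarrow> real ^ 'n \<Rightarrow> real ^ 'n) \<Rightarrow> (real ^ 'n \<Rightarrow> real ^ 'n \<Rightarrow> real ^ 'n) \<Rightarrow>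
   (real ^ 'n \<Rightarrow> real ^ 'n) \<Rightarrow> (real ^ 'n \<Rightarrow> real ^ 'n) \<Rightarrow> real ^ 'n \<Rightarrow> real ^ 'n" where
  "parallel_transport H K t \<tau> x = lambda_mat (mult_fun H K) x (t x) *v \<tau> (act_fun K x (t x))"

text \<open>\<open>\<tau>\<^sub>\<parallel>\<^sup>m(x) = \<tau>\<^sup>m(x) + t\<^sup>n(x) N\<^sub>n\<^sup>m(x)\<close> to first order in \<open>t(x)\<close>, for group elements \<open>t\<close>.\<close>

definition infinitesimal_transport ::
  "(real ^ 'n::finite) set \<Rightarrow> (real ^ 'n \<Rightarrow> real ^ 'n \<Rightarrow> real ^ 'n) \<Rightarrow>
   (real ^ 'n \<Rightarrow> real ^ 'n \<Rightarrow> real ^ 'n) \<Rightarrow> (real ^ 'n \<Rightarrow> real ^ 'n) \<Rightarrow>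
   ('n \<Rightarrow> real ^ 'n \<Rightarrow> real ^ 'n) \<Rightarrow> bool" where
  "infinitesimal_transport U H K \<tau> N \<longleftrightarrow>
     (\<forall>x\<in>U. \<forall>e>0. \<exists>d>0. \<forall>t\<in>deformed_group U H. norm (t x) < d \<longrightarrow> act_fun K x (t x) \<in> U \<longrightarrow>
        norm (parallel_transport H K t \<tau> x - \<tau> x - (\<Sum>n\<in>UNIV. t x $ n *\<^sub>R N n x)) \<le> e * norm (t x))"

text \<open>The deformed group specifies \<open>\<nabla>\<close> if, for every smooth field \<open>\<tau> = \<tau>\<^sup>m X\<^sub>m\<close>, the components of
  \<open>\<nabla>\<^bsub>X\<^sub>n\<^esub> \<tau>\<close> in the frame are the first-order coefficients of the parallel transport rule.\<close>

definition specifies_connection ::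
  "(real ^ 'n::finite) set \<Rightarrow> (real ^ 'n \<Rightarrow> real ^ 'n \<Rightarrow> real ^ 'n) \<Rightarrow>
   (real ^ 'n \<Rightarrow> real ^ 'n \<Rightarrow> real ^ 'n) \<Rightarrow> ('n vfield \<Rightarrow> 'n vfield \<Rightarrow> 'n vfield) \<Rightarrow> bool" where
  "specifies_connection U H K D \<longleftrightarrow>
     affine_connection U D \<and>
     (\<forall>\<tau>. smooth_on U \<tau> \<longrightarrow>
        (\<exists>N. infinitesimal_transport U H K \<tau> N \<and>
             (\<forall>n. \<forall>x\<in>U. D (vielbein H n) (field_of_comps H \<tau>) x = field_of_comps H (N n) x)))"

end

theory Submission
  imports Defs
begin

text \<open>
  Write \<open>\<Gamma>\<^sub>x(u,v) = h(x)\<inverse> \<partial>\<^sub>s\<^sup>2 H(x,s)(u,v)\<close> at \<open>s = 0\<close>. This is symmetric and bilinear in \<open>u\<close>, \<open>v\<close>,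
  and everything taken from the multiplication law is expressed through it: the chain rule applied
  to \<open>\<lambda>(x,t) = \<partial>\<^sub>sH(x,K(x,t)) \<partial>\<^sub>tK(x',0)\<close> shows that the transport rule defines the connection whose
  Christoffel symbols in the coordinates \<open>x\<^sup>\<mu>\<close> are \<open>\<Gamma>\<close>, hence a torsion-free one. Differentiating
  \<open>H(x,K(x,t)) = t\<close> in \<open>x\<close> gives \<open>\<mu>(x,t)\<^sub>n = (\<partial>\<^sub>s - \<partial>\<^sub>x)H(x,K(x,t)) X\<^sub>n\<close>; two derivatives in \<open>t\<close> of this
  are a term symmetric in all indices minus \<open>h((X\<^sub>n\<Gamma>)(X\<^sub>l,X\<^sub>k) + \<Gamma>(X\<^sub>n,\<Gamma>(X\<^sub>l,X\<^sub>k)))\<close>, and the antisymmetric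
  part is the coordinate expression of the curvature.

  Conversely, given a torsion-free connection, \<open>H\<close> must be globally invertible in \<open>s\<close> with \<open>h = 1\<close> and
  second derivative \<open>\<Gamma>\<close>. By polarization \<open>\<Gamma>\<close> is a sum of terms \<open>l(u) l(v) p(x)\<close>. A single term is
  realized by \<open>s \<mapsto> s + \<theta>(l(s)) p(x)\<close> with an explicit \<open>\<theta>(r) = r\<^sup>2/2 + O(r\<^sup>4)\<close> of small slope, and
  composition adds the second derivatives.
\<close>

subsection \<open>Directional derivatives and smooth maps\<close>

text \<open>The direction comes first, so that \<open>dird v f\<close> is again a function of the
  point and second derivatives read \<open>dird u (dird v f)\<close>.\<close>

definition dird :: "'a \<Rightarrow> ('a::real_normed_vector \<Rightarrow> 'b::real_normed_vector) \<Rightarrow> 'a \<Rightarrow> 'b" where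
  "dird v f x = frechet_derivative f (at x) v"

lemma dird_eq: "(f has_derivative f') (at x) \<Longrightarrow> dird v f x = f' v"
  unfolding dird_def using frechet_derivative_at by metis

lemma has_derivative_dird: "f differentiable (at x) \<Longrightarrow> (f has_derivative (\<lambda>v. dird v f x)) (at x)"
  unfolding dird_def frechet_derivative_works by simp

lemma bounded_linear_dird: "f differentiable (at x) \<Longrightarrow> bounded_linear (\<lambda>v. dird v f x)"
  using has_derivative_dird has_derivative_bounded_linear by blast

lemma linear_dird: "f differentiable (at x) \<Longrightarrow> linear (\<lambda>v. dird v f x)"
  using bounded_linear_dird bounded_linear.linear by blast

text \<open>Derivatives are local. Functions on a chart are total with arbitrary values outside it,
  so every later rewriting of an integrand of \<open>dird\<close> goes through an open set.\<close>

lemma differentiable_cong_open: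
  assumes "open S" "x \<in> S" "\<And>y. y \<in> S \<Longrightarrow> f y = g y" "f differentiable (at x)"
  shows "g differentiable (at x)" "dird v g x = dird v f x"
proof -
  have "(g has_derivative (\<lambda>v. dird v f x)) (at x)"
    using has_derivative_transform_within_open[OF has_derivative_dird[OF assms(4)] assms(1,2)] assms(3)
    by auto
  then show "g differentiable (at x)" "dird v g x = dird v f x"
    by (auto simp: dird_eq differentiableI)
qed

lemma dird_cong:
  assumes "open S" "x \<in> S" "\<And>y. y \<in> S \<Longrightarrow> f y = g y" "f differentiable (at x)"
  shows "dird v f x = dird v g x"
  using differentiable_cong_open(2)[OF assms] by simp

section \<open>Maps of finite differentiability order: closure under linear maps, products and
  composition\<close>

lemma Ck_on_Suc:
  "Ck_on (Suc k) S f \<longleftrightarrow> (\<forall>x\<in>S. f differentiable (at x)) \<and> (\<forall>v. Ck_on k S (dird v f))"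
  by (simp add: dird_def[abs_def])

lemma Ck_on_cong:
  assumes "open S" "\<And>x. x \<in> S \<Longrightarrow> f x = g x"
  shows "Ck_on k S f \<longleftrightarrow> Ck_on k S g"
  using assms(2)
proof (induction k arbitrary: f g)
  case 0
  then show ?case by (simp cong: continuous_on_cong)
next
  case (Suc k)
  have *: "Ck_on (Suc k) S g" if "\<And>x. x \<in> S \<Longrightarrow> f x = g x" "Ck_on (Suc k) S f" for f g :: "'a \<Rightarrow> 'b"
  proof -
    have "f differentiable (at x)" if "x \<in> S" for x
      using that \<open>Ck_on (Suc k) S f\<close> by (simp only: Ck_on_Suc)
    then have "\<forall>x\<in>S. g differentiable (at x) \<and> (\<forall>v. dird v g x = dird v f x)"
      using differentiable_cong_open[OF assms(1)] that(1) by metis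
    moreover from this have "Ck_on k S (dird v g) \<longleftrightarrow> Ck_on k S (dird v f)" for v
      by (intro Suc.IH) auto
    ultimately show ?thesis using that(2) unfolding Ck_on_Suc[of k] by blast
  qed
  show ?case using *[of f g] *[of g f] Suc.prems by fastforce
qed

text \<open>The induction step in usable form: any explicit derivative may stand in for
  \<open>frechet_derivative\<close>, because both agree on the open set.\<close>

lemma Ck_on_SucI:
  assumes "open S" "\<And>x. x \<in> S \<Longrightarrow> (f has_derivative f' x) (at x)"
    and "\<And>v. Ck_on k S (\<lambda>x. f' x v)"
  shows "Ck_on (Suc k) S f"
proof -
  have "Ck_on k S (dird v f)" for v
    using Ck_on_cong[OF assms(1), of "dird v f" "\<lambda>x. f' x v"] assms(2,3) by (simp add: dird_eq)
  then show ?thesis using assms(2) by (auto simp only: Ck_on_Suc differentiable_def)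
qed

lemma Ck_on_SucD: "Ck_on (Suc k) S f \<Longrightarrow> Ck_on k S f"
proof (induction k arbitrary: f)
  case 0
  then show ?case
    by (auto simp: continuous_on_eq_continuous_at differentiable_imp_continuous_within
        intro!: continuous_at_imp_continuous_on)
next
  case (Suc k)
  have "Ck_on k S (dird v f)" for v
    using Suc.prems unfolding Ck_on_Suc[of "Suc k"] by (blast intro: Suc.IH)
  moreover have "\<forall>x\<in>S. f differentiable (at x)" using Suc.prems unfolding Ck_on_Suc[of "Suc k"] by blast
  ultimately show ?case unfolding Ck_on_Suc[of k] by blast
qed

lemma Ck_on_has_derivative:
  "Ck_on (Suc k) S f \<Longrightarrow> x \<in> S \<Longrightarrow> (f has_derivative (\<lambda>v. dird v f x)) (at x)"
  by (simp only: Ck_on_Suc has_derivative_dird)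

lemma Ck_on_dird: "Ck_on (Suc k) S f \<Longrightarrow> Ck_on k S (dird v f)"
  by (simp only: Ck_on_Suc)

lemma Ck_on_const: "open S \<Longrightarrow> Ck_on k S (\<lambda>x. c)"
proof (induction k arbitrary: c)
  case (Suc k)
  then show ?case by (intro Ck_on_SucI[where f' = "\<lambda>x v. 0"]) auto
qed simp

lemma Ck_on_bounded_linear:
  assumes "open S" "bounded_linear L"
  shows "Ck_on k S L"
proof (cases k)
  case 0
  then show ?thesis using assms by (simp add: linear_continuous_on)
next
  case (Suc l)
  then show ?thesis using assms
    by (auto intro!: Ck_on_SucI[where f' = "\<lambda>x. L"] bounded_linear_imp_has_derivative Ck_on_const
        simp del: Ck_on.simps)
qed

lemma Ck_on_compose_linear:
  assumes "open S" "bounded_linear L" "Ck_on k S f"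
  shows "Ck_on k S (\<lambda>x. L (f x))"
  using assms(3)
proof (induction k arbitrary: f)
  case 0
  then show ?case using assms(2)
    by (simp add: bounded_linear.continuous_on)
next
  case (Suc k)
  show ?case
    by (rule Ck_on_SucI[OF assms(1) bounded_linear.has_derivative[OF assms(2) Ck_on_has_derivative]])
       (auto simp del: Ck_on.simps intro: Suc Ck_on_dird)
qed

lemma Ck_on_add:
  assumes "open S" "Ck_on k S f" "Ck_on k S g"
  shows "Ck_on k S (\<lambda>x. f x + g x)"
  using assms(2,3)
proof (induction k arbitrary: f g)
  case (Suc k)
  show ?case
    by (rule Ck_on_SucI[OF assms(1) has_derivative_add[OF Ck_on_has_derivative Ck_on_has_derivative]])
       (auto simp del: Ck_on.simps intro: Suc Ck_on_dird)
qed (auto intro: continuous_intros)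

text \<open>The product rule yields two terms of the same shape, one factor differentiated and the
  other lowered by one order, so the induction hypothesis applies to each.\<close>

lemma Ck_on_bilinear:
  assumes "open S" "bounded_bilinear B" "Ck_on k S f" "Ck_on k S g"
  shows "Ck_on k S (\<lambda>x. B (f x) (g x))"
  using assms(3,4)
proof (induction k arbitrary: f g)
  case 0
  then show ?case using assms(2) by (simp add: bounded_bilinear.continuous_on)
next
  case (Suc k)
  show ?case
    by (rule Ck_on_SucI[OF assms(1)
          bounded_bilinear.FDERIV[OF assms(2) Ck_on_has_derivative Ck_on_has_derivative]])
       (use Suc in \<open>auto simp del: Ck_on.simps
         intro!: Suc.IH Ck_on_dird[where f = f] Ck_on_dird[where f = g] Ck_on_add[OF assms(1)] intro: Ck_on_SucD\<close>)
qed

lemma Ck_on_sum: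
  assumes "open S" "\<And>i. i \<in> I \<Longrightarrow> Ck_on k S (f i)"
  shows "Ck_on k S (\<lambda>x. \<Sum>i\<in>I. f i x)"
  using assms(2)
  by (induction I rule: infinite_finite_induct) (auto intro: Ck_on_add Ck_on_const assms(1))

lemma dird_Basis:
  fixes f :: "'a::euclidean_space \<Rightarrow> 'b::real_normed_vector"
  assumes "f differentiable (at x)"
  shows "dird v f x = (\<Sum>b\<in>Basis. (v \<bullet> b) *\<^sub>R dird b f x)"
proof -
  have "dird v f x = dird (\<Sum>b\<in>Basis. (v \<bullet> b) *\<^sub>R b) f x" by (simp add: euclidean_representation)
  also have "\<dots> = (\<Sum>b\<in>Basis. (v \<bullet> b) *\<^sub>R dird b f x)"
    by (simp add: linear_sum[OF linear_dird[OF assms]] linear_scale[OF linear_dird[OF assms]])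
  finally show ?thesis .
qed

text \<open>\<open>Ck_on\<close> controls only derivatives in fixed directions, while the chain rule
  produces a direction that moves with the point. Expanding it in the basis leaves finitely many
  fixed directions with scalar coefficients.\<close>

lemma Ck_on_dird_along:
  fixes f :: "'a::euclidean_space \<Rightarrow> 'b::real_normed_vector"
  assumes "open S" "\<And>x. x \<in> S \<Longrightarrow> f differentiable (at (g x))"
    and "\<And>b. Ck_on k S (\<lambda>x. dird b f (g x))" "Ck_on k S w"
  shows "Ck_on k S (\<lambda>x. dird (w x) f (g x))"
proof -
  have "Ck_on k S (\<lambda>x. \<Sum>b\<in>Basis. (w x \<bullet> b) *\<^sub>R dird b f (g x))"
    using assms by (intro Ck_on_sum Ck_on_bilinear[OF _ bounded_bilinear_scaleR]
        Ck_on_compose_linear[OF _ bounded_linear_inner_left])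
  then show ?thesis
    by (rule Ck_on_cong[OF assms(1), THEN iffD1, rotated]) (simp add: dird_Basis[OF assms(2), symmetric])
qed

text \<open>Induction on the order for varying \<open>f\<close> and fixed \<open>g\<close>: the
  derivative of the composite is the derivative of \<open>f\<close> at \<open>g x\<close> in the
  moving direction \<open>dird v g x\<close>.\<close>

lemma Ck_on_compose:
  fixes f :: "'a::euclidean_space \<Rightarrow> 'b::real_normed_vector"
  assumes "open S" "open T" "g ` S \<subseteq> T" "Ck_on k T f" "Ck_on k S g"
  shows "Ck_on k S (\<lambda>x. f (g x))"
  using assms(4,5)
proof (induction k arbitrary: f)
  case 0
  then show ?case using assms(3) by (auto intro: continuous_on_compose2)
next
  case (Suc k)
  have g: "g x \<in> T" if "x \<in> S" for x using assms(3) that by auto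
  show ?case
  proof (rule Ck_on_SucI[OF assms(1)])
    show "((\<lambda>x. f (g x)) has_derivative (\<lambda>v. dird (dird v g x) f (g x))) (at x)" if "x \<in> S" for x
      using has_derivative_compose[OF Ck_on_has_derivative Ck_on_has_derivative, OF Suc.prems(2) that
          Suc.prems(1) g[OF that]] .
    show "Ck_on k S (\<lambda>x. dird (dird v g x) f (g x))" for v
    proof (rule Ck_on_dird_along[OF assms(1)])
      show "f differentiable (at (g x))" if "x \<in> S" for x
        using Suc.prems(1) g[OF that] by (simp only: Ck_on_Suc)
      show "Ck_on k S (\<lambda>x. dird b f (g x))" for b
        using Suc.IH[OF Ck_on_dird[OF Suc.prems(1)] Ck_on_SucD[OF Suc.prems(2)]] .
      show "Ck_on k S (dird v g)" using Ck_on_dird[OF Suc.prems(2)] .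
    qed
  qed
qed

section \<open>Smooth maps, including reciprocal and square root\<close>

lemma smooth_on_has_derivative:
  "smooth_on S f \<Longrightarrow> x \<in> S \<Longrightarrow> (f has_derivative (\<lambda>v. dird v f x)) (at x)"
  unfolding smooth_on_def using Ck_on_has_derivative by blast

lemma smooth_on_differentiable: "smooth_on S f \<Longrightarrow> x \<in> S \<Longrightarrow> f differentiable (at x)"
  using smooth_on_has_derivative differentiableI by blast

lemma smooth_on_continuous_on: "smooth_on S f \<Longrightarrow> continuous_on S f"
  unfolding smooth_on_def using Ck_on.simps(1) by blast

lemma smooth_on_dird: "smooth_on S f \<Longrightarrow> smooth_on S (dird v f)"
  unfolding smooth_on_def using Ck_on_dird by blast

lemma smooth_on_cong:
  "open S \<Longrightarrow> (\<And>x. x \<in> S \<Longrightarrow> f x = g x) \<Longrightarrow> smooth_on S f \<longleftrightarrow> smooth_on S g"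
  unfolding smooth_on_def using Ck_on_cong by metis

lemma smooth_on_const: "open S \<Longrightarrow> smooth_on S (\<lambda>x. c)"
  unfolding smooth_on_def by (simp add: Ck_on_const)

lemma smooth_on_bounded_linear: "open S \<Longrightarrow> bounded_linear L \<Longrightarrow> smooth_on S L"
  unfolding smooth_on_def by (simp add: Ck_on_bounded_linear)

lemma smooth_on_compose_linear:
  "open S \<Longrightarrow> bounded_linear L \<Longrightarrow> smooth_on S f \<Longrightarrow> smooth_on S (\<lambda>x. L (f x))"
  unfolding smooth_on_def by (simp add: Ck_on_compose_linear)

lemma smooth_on_add:
  "open S \<Longrightarrow> smooth_on S f \<Longrightarrow> smooth_on S g \<Longrightarrow> smooth_on S (\<lambda>x. f x + g x)"
  unfolding smooth_on_def by (simp add: Ck_on_add)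

lemma smooth_on_minus: "open S \<Longrightarrow> smooth_on S f \<Longrightarrow> smooth_on S (\<lambda>x. - f x)"
  by (rule smooth_on_compose_linear[OF _ bounded_linear_minus[OF bounded_linear_ident]])

lemma smooth_on_diff:
  "open S \<Longrightarrow> smooth_on S f \<Longrightarrow> smooth_on S g \<Longrightarrow> smooth_on S (\<lambda>x. f x - g x)"
  using smooth_on_add[of S f "\<lambda>x. - g x"] smooth_on_minus[of S g] by simp

lemma smooth_on_bilinear:
  "open S \<Longrightarrow> bounded_bilinear B \<Longrightarrow> smooth_on S f \<Longrightarrow> smooth_on S g \<Longrightarrow>
     smooth_on S (\<lambda>x. B (f x) (g x))"
  unfolding smooth_on_def by (simp add: Ck_on_bilinear)

lemmas smooth_on_scaleR = smooth_on_bilinear[OF _ bounded_bilinear_scaleR]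
lemmas smooth_on_mult =
  smooth_on_bilinear[OF _ bounded_bilinear_mult[where 'a = "'b::real_normed_algebra"]]

lemma smooth_on_sum:
  "open S \<Longrightarrow> (\<And>i. i \<in> I \<Longrightarrow> smooth_on S (f i)) \<Longrightarrow> smooth_on S (\<lambda>x. \<Sum>i\<in>I. f i x)"
  unfolding smooth_on_def by (simp add: Ck_on_sum)

lemma smooth_on_compose:
  fixes f :: "'a::euclidean_space \<Rightarrow> 'b::real_normed_vector"
  shows "smooth_on T f \<Longrightarrow> smooth_on S g \<Longrightarrow> open S \<Longrightarrow> open T \<Longrightarrow> g ` S \<subseteq> T \<Longrightarrow>
    smooth_on S (\<lambda>x. f (g x))"
  unfolding smooth_on_def using Ck_on_compose by metis

text \<open>A pair is the sum of its two images under the linear embeddings into the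
  product.\<close>

lemma smooth_on_Pair:
  assumes "open S" "smooth_on S f" "smooth_on S g"
  shows "smooth_on S (\<lambda>x. (f x, g x))"
proof -
  have "smooth_on S (\<lambda>x. (f x, 0) + (0, g x))"
    using assms
    by (intro smooth_on_add smooth_on_compose_linear[where L = "\<lambda>y. (y, 0)"]
        smooth_on_compose_linear[where L = "\<lambda>y. (0, y)"] bounded_linear_Pair
        bounded_linear_ident bounded_linear_zero)
  then show ?thesis by simp
qed

lemma smooth_on_dird_along:
  fixes f :: "'a::euclidean_space \<Rightarrow> 'b::real_normed_vector"
  assumes "smooth_on T f" "smooth_on S g" "smooth_on S w" "open S" "open T" "g ` S \<subseteq> T"
  shows "smooth_on S (\<lambda>x. dird (w x) f (g x))"
  unfolding smooth_on_def
proof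
  fix k
  have "smooth_on S (\<lambda>x. dird b f (g x))" for b
    using smooth_on_compose[OF smooth_on_dird[OF assms(1)] assms(2,4,5,6)] .
  moreover have "f differentiable (at (g x))" if "x \<in> S" for x
    using smooth_on_differentiable[OF assms(1)] assms(6) that by auto
  ultimately show "Ck_on k S (\<lambda>x. dird (w x) f (g x))"
    using assms(3) Ck_on_dird_along[OF assms(4)] unfolding smooth_on_def by blast
qed

text \<open>The derivative is a constant times the square of the function itself, so each order
  gives the next.\<close>

lemma smooth_on_inverse:
  "smooth_on {0<..} (inverse :: real \<Rightarrow> real)"
  unfolding smooth_on_def
proof
  show "Ck_on k {0<..} (inverse :: real \<Rightarrow> real)" for k
  proof (induction k)
    case 0
    then show ?case by (auto intro!: continuous_intros)
  next
    case (Suc k)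
    show ?case
    proof (rule Ck_on_SucI)
      show "(inverse has_derivative (\<lambda>h. - (inverse x * h * inverse x))) (at x)"
        if "x \<in> {0<..}" for x :: real
        using that by (intro has_derivative_inverse') auto
      have "Ck_on k {0<..} (\<lambda>x. (- v) * (inverse x * inverse x))" for v :: real
        by (intro Ck_on_bilinear[OF _ bounded_bilinear_mult] Ck_on_const Suc) auto
      then show "Ck_on k {0<..} (\<lambda>x. - (inverse x * v * inverse x))" for v :: real
        by (simp add: ac_simps)
    qed auto
  qed
qed

text \<open>The derivative is a constant times the reciprocal of the function, again reducing one
  order to the previous one.\<close>

lemma smooth_on_sqrt: "smooth_on {0<..} sqrt"
  unfolding smooth_on_def
proof
  show "Ck_on k {0<..} sqrt" for k
  proof (induction k)
    case 0
    then show ?case by (auto intro!: continuous_intros)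
  next
    case (Suc k)
    show ?case
    proof (rule Ck_on_SucI)
      show "(sqrt has_derivative (\<lambda>h. h * (inverse (sqrt x) / 2))) (at x)" if "x \<in> {0<..}" for x :: real
        by (rule has_derivative_eq_rhs[OF DERIV_real_sqrt[unfolded has_field_derivative_def]])
           (use that in \<open>auto simp: mult.commute\<close>)
      have "Ck_on k {0<..} (\<lambda>x. (v / 2) * inverse (sqrt x))" for v
      proof -
        have "Ck_on k {0<..} (\<lambda>x. inverse (sqrt x))"
          by (rule Ck_on_compose[where T = "{0<..}" and f = inverse])
             (use smooth_on_inverse Suc in \<open>auto simp: smooth_on_def\<close>)
        from Ck_on_bilinear[OF open_greaterThan bounded_bilinear_mult
            Ck_on_const[OF open_greaterThan, where c = "v / 2"] this]
        show ?thesis .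
      qed
      then show "Ck_on k {0<..} (\<lambda>x. v * (inverse (sqrt x) / 2))" for v
        by (simp add: ac_simps)
    qed auto
  qed
qed

text \<open>Linearity in the inner direction: the basis expansion of \<open>dird v f\<close> holds
  on all of the open set, hence may be differentiated once more.\<close>

lemma dird_dird_Basis:
  fixes f :: "'a::euclidean_space \<Rightarrow> 'b::real_normed_vector"
  assumes "smooth_on S f" "open S" "z \<in> S"
  shows "dird u (dird v f) z = (\<Sum>i\<in>Basis. (v \<bullet> i) *\<^sub>R dird u (dird i f) z)"
proof -
  have "((\<lambda>z. \<Sum>i\<in>Basis. (v \<bullet> i) *\<^sub>R dird i f z) has_derivative
      (\<lambda>b. \<Sum>i\<in>Basis. (v \<bullet> i) *\<^sub>R dird b (dird i f) z)) (at z)"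
    using smooth_on_has_derivative[OF smooth_on_dird[OF assms(1)] assms(3)]
    by (intro has_derivative_sum has_derivative_scaleR_right)
  then have "((dird v f) has_derivative
      (\<lambda>b. \<Sum>i\<in>Basis. (v \<bullet> i) *\<^sub>R dird b (dird i f) z)) (at z)"
    by (rule has_derivative_transform_within_open[OF _ assms(2,3)])
       (simp add: dird_Basis[OF smooth_on_differentiable[OF assms(1)]])
  then show ?thesis by (rule dird_eq)
qed

lemma bilinear_dird_dird:
  fixes f :: "'a::euclidean_space \<Rightarrow> 'b::real_normed_vector"
  assumes "smooth_on S f" "open S" "z \<in> S"
  shows "bilinear (\<lambda>u v. dird u (dird v f) z)"
  unfolding bilinear_def
proof (intro conjI allI)
  show "linear (\<lambda>u. dird u (dird v f) z)" for v
    by (rule linear_dird[OF smooth_on_differentiable[OF smooth_on_dird[OF assms(1)] assms(3)]])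
  have "linear (\<lambda>v. \<Sum>i\<in>Basis. (v \<bullet> i) *\<^sub>R dird u (dird i f) z)" for u
    by (intro linearI) (simp_all add: inner_add_left scaleR_add_left sum.distrib scaleR_sum_right)
  moreover have "(\<lambda>v. dird u (dird v f) z) = (\<lambda>v. \<Sum>i\<in>Basis. (v \<bullet> i) *\<^sub>R dird u (dird i f) z)" for u
    by (rule ext) (rule dird_dird_Basis[OF assms])
  ultimately show "linear (\<lambda>v. dird u (dird v f) z)" for u
    by presburger
qed

text \<open>The inner direction \<open>w x\<close> is frozen while the outer derivative is taken, so
  no derivative of \<open>w\<close> enters.\<close>

lemma smooth_on_dird_dird_along:
  fixes f :: "'a::euclidean_space \<Rightarrow> 'b::real_normed_vector"
  assumes "smooth_on T f" "smooth_on S g" "smooth_on S v" "smooth_on S w" "open S" "open T" "g ` S \<subseteq> T"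
  shows "smooth_on S (\<lambda>x. dird (v x) (dird (w x) f) (g x))"
proof -
  have "smooth_on S (\<lambda>x. \<Sum>i\<in>Basis. (w x \<bullet> i) *\<^sub>R dird (v x) (dird i f) (g x))"
    using smooth_on_scaleR[OF assms(5) smooth_on_compose_linear[OF assms(5) bounded_linear_inner_left assms(4)]
        smooth_on_dird_along[OF smooth_on_dird[OF assms(1)] assms(2,3,5,6,7)]]
    by (intro smooth_on_sum assms(5))
  moreover have "dird (v x) (dird (w x) f) (g x)
      = (\<Sum>i\<in>Basis. (w x \<bullet> i) *\<^sub>R dird (v x) (dird i f) (g x))" if "x \<in> S" for x
    using assms(7) that by (intro dird_dird_Basis[OF assms(1,6)]) auto
  ultimately show ?thesis
    by (subst smooth_on_cong[OF assms(5)]) auto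
qed

text \<open>The main calculus rule below: one term moves the base point with the direction frozen,
  the other differentiates the direction. It follows from the product rule after expanding the
  direction in the basis.\<close>

lemma has_derivative_dird_along:
  fixes f :: "'a::euclidean_space \<Rightarrow> 'b::real_normed_vector"
  assumes "smooth_on S f" "open S" "g x \<in> S"
    and g: "(g has_derivative g') (at x)" and w: "(w has_derivative w') (at x)"
  shows "((\<lambda>y. dird (w y) f (g y)) has_derivative
      (\<lambda>u. dird (g' u) (dird (w x) f) (g x) + dird (w' u) f (g x))) (at x)"
proof -
  let ?s = "\<lambda>y. \<Sum>b\<in>Basis. (w y \<bullet> b) *\<^sub>R dird b f (g y)"
  let ?d = "\<lambda>u. \<Sum>b\<in>Basis. (w x \<bullet> b) *\<^sub>R dird (g' u) (dird b f) (g x) + (w' u \<bullet> b) *\<^sub>R dird b f (g x)"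
  have diff: "dird b f differentiable (at z)" "f differentiable (at z)" if "z \<in> S" for b z
    using smooth_on_dird[OF assms(1)] assms(1) that smooth_on_differentiable by blast+
  have "((\<lambda>y. dird b f (g y)) has_derivative (\<lambda>u. dird (g' u) (dird b f) (g x))) (at x)" for b
    using has_derivative_compose[OF g has_derivative_dird[OF diff(1)[OF assms(3)]]] .
  then have 1: "(?s has_derivative ?d) (at x)"
    by (intro has_derivative_sum has_derivative_scaleR has_derivative_inner_left w)
  \<comment> \<open>The basis expansion is valid only where \<open>f\<close> is differentiable, so
    \<open>g\<close> must be kept inside \<open>S\<close> near \<open>x\<close>.\<close>
  have cont: "continuous (at x) g" using g has_derivative_continuous by blast
  have "\<forall>\<^sub>F y in nhds x. g y \<in> S"
    using topological_tendstoD[OF tendsto_at_iff_tendsto_nhds[THEN iffD1, OF isContD[OF cont]] assms(2,3)] .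
  then obtain V where V: "open V" "x \<in> V" "\<And>y. y \<in> V \<Longrightarrow> g y \<in> S"
    unfolding eventually_nhds by blast
  have 2: "((\<lambda>y. dird (w y) f (g y)) has_derivative ?d) (at x)"
    using V by (intro has_derivative_transform_within_open[OF 1, of V]) (auto simp: dird_Basis[OF diff(2)])
  have "?d = (\<lambda>u. dird (g' u) (dird (w x) f) (g x) + dird (w' u) f (g x))"
    by (simp add: sum.distrib dird_dird_Basis[OF assms(1,2,3), where v = "w x"]
        dird_Basis[OF diff(2)[OF assms(3)], of "w' _", symmetric])
  with 2 show ?thesis by simp
qed

lemma dird_compose:
  assumes "(g has_derivative g') (at x)" "f differentiable (at (g x))"
  shows "dird v (\<lambda>x. f (g x)) x = dird (g' v) f (g x)"
  using dird_eq[OF has_derivative_compose[OF assms(1) has_derivative_dird[OF assms(2)]]] .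

subsection \<open>Symmetry of second derivatives\<close>

text \<open>The mean value theorem is applied twice: along \<open>u\<close> to the increment of
  \<open>f\<close> by \<open>t\<close> times \<open>v\<close>, then along \<open>v\<close> to the
  derivative \<open>dird u f\<close>.\<close>

lemma second_difference_mean_value:
  fixes f :: "'a::euclidean_space \<Rightarrow> real"
  assumes "smooth_on S f" "open S" "0 < t"
    and S: "\<And>a b. 0 \<le> a \<Longrightarrow> a \<le> t \<Longrightarrow> 0 \<le> b \<Longrightarrow> b \<le> t \<Longrightarrow> x + a *\<^sub>R u + b *\<^sub>R v \<in> S"
  obtains a b where "0 < a" "a < t" "0 < b" "b < t"
    "f (x + t *\<^sub>R u + t *\<^sub>R v) - f (x + t *\<^sub>R u) - f (x + t *\<^sub>R v) + f x
       = t * (t * dird v (dird u f) (x + a *\<^sub>R u + b *\<^sub>R v))"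
proof -
  have line: "((\<lambda>a. F (p + a *\<^sub>R q)) has_real_derivative dird q F (p + a *\<^sub>R q)) (at a)"
    if "smooth_on S F" "p + a *\<^sub>R q \<in> S" for F :: "'a \<Rightarrow> real" and p q a
  proof -
    have "((\<lambda>a. p + a *\<^sub>R q) has_derivative (\<lambda>h. h *\<^sub>R q)) (at a)"
      by (auto intro!: derivative_eq_intros)
    from has_derivative_compose[OF this smooth_on_has_derivative[OF that]]
    show ?thesis
      using linear_scale[OF linear_dird[OF smooth_on_differentiable[OF that]]]
      by (simp add: has_field_derivative_def mult_commute_abs)
  qed
  define \<phi> where "\<phi> a = f ((x + t *\<^sub>R v) + a *\<^sub>R u) - f (x + a *\<^sub>R u)" for a
  have d\<phi>: "(\<phi> has_real_derivative dird u f ((x + t *\<^sub>R v) + a *\<^sub>R u) - dird u f (x + a *\<^sub>R u)) (at a)"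
    if "0 \<le> a" "a \<le> t" for a
    unfolding \<phi>_def using that S[of a t] S[of a 0] assms(3)
    by (intro DERIV_diff line assms(1)) (auto simp: algebra_simps)
  obtain a where a: "0 < a" "a < t"
    "\<phi> t - \<phi> 0 = t * (dird u f ((x + t *\<^sub>R v) + a *\<^sub>R u) - dird u f (x + a *\<^sub>R u))"
    using MVT2[OF assms(3), of \<phi>, OF d\<phi>] by auto
  obtain b where b: "0 < b" "b < t"
    "dird u f ((x + a *\<^sub>R u) + t *\<^sub>R v) - dird u f ((x + a *\<^sub>R u) + 0 *\<^sub>R v)
       = t * dird v (dird u f) ((x + a *\<^sub>R u) + b *\<^sub>R v)"
    using MVT2[OF assms(3), of "\<lambda>b. dird u f ((x + a *\<^sub>R u) + b *\<^sub>R v)",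
        OF line[OF smooth_on_dird[OF assms(1)]]] S[of a] a(1,2) by auto
  show ?thesis
    using that[OF a(1,2) b(1,2)] a(3) b(3) by (simp add: \<phi>_def algebra_simps)
qed

text \<open>The second difference is symmetric in \<open>u\<close> and \<open>v\<close>, so both
  mixed derivatives attain the same value at points arbitrarily close to \<open>x\<close>.
  Continuity then forbids a gap at \<open>x\<close>.\<close>

lemma dird_commute_real:
  fixes f :: "'a::euclidean_space \<Rightarrow> real"
  assumes f: "smooth_on S f" and "open S" "x \<in> S"
  shows "dird u (dird v f) x = dird v (dird u f) x"
proof (rule ccontr)
  let ?P = "dird u (dird v f)" and ?Q = "dird v (dird u f)"
  define e where "e = \<bar>?P x - ?Q x\<bar> / 2"
  assume "?P x \<noteq> ?Q x"
  then have e: "e > 0" by (simp add: e_def)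
  have "isCont ?P x" "isCont ?Q x"
    using smooth_on_continuous_on[OF smooth_on_dird[OF smooth_on_dird[OF f]]] assms(2,3)
      continuous_on_eq_continuous_at by blast+
  moreover have "\<exists>d>0. \<forall>y. dist y x < d \<longrightarrow> \<bar>R y - R x\<bar> < e" if "isCont R x" for R :: "'a \<Rightarrow> real"
    using that e by (simp add: continuous_at_eps_delta dist_real_def)
  ultimately obtain d1 d2 where d: "d1 > 0" "\<And>y. dist y x < d1 \<Longrightarrow> \<bar>?P y - ?P x\<bar> < e"
      "d2 > 0" "\<And>y. dist y x < d2 \<Longrightarrow> \<bar>?Q y - ?Q x\<bar> < e"
    by metis
  obtain d3 where d3: "d3 > 0" "ball x d3 \<subseteq> S" using assms(2,3) open_contains_ball by blast
  define d0 where "d0 = Min {d1, d2, d3}"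
  have d0: "d0 > 0" "d0 \<le> d1" "d0 \<le> d2" "d0 \<le> d3" using d d3 by (auto simp: d0_def)
  \<comment> \<open>This size keeps the whole parallelogram spanned by \<open>t\<close> times
    \<open>u\<close> and \<open>v\<close> within \<open>d0\<close> of \<open>x\<close>; the summand
    1 keeps the denominator positive when both directions vanish.\<close>
  define t where "t = d0 / (2 * (norm u + norm v + 1))"
  have t: "t > 0" using d0 by (simp add: t_def add_nonneg_pos)
  have "t * (norm u + norm v) < t * (2 * (norm u + norm v + 1))"
    using t by (intro mult_strict_left_mono) (auto simp: add_nonneg_pos add_pos_nonneg)
  also have "\<dots> = d0"
    using add_nonneg_pos[of "norm u + norm v" 1] unfolding t_def by (simp add: field_simps)
  finally have tn: "t * (norm u + norm v) < d0" .
  have near: "dist (x + a *\<^sub>R u + b *\<^sub>R v) x < d0" if "0 \<le> a" "a \<le> t" "0 \<le> b" "b \<le> t" for a b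
  proof -
    have "norm (a *\<^sub>R u + b *\<^sub>R v) \<le> a * norm u + b * norm v"
      using norm_triangle_ineq[of "a *\<^sub>R u" "b *\<^sub>R v"] that by simp
    also have "\<dots> \<le> t * norm u + t * norm v" using that by (intro add_mono mult_right_mono) auto
    finally show ?thesis using tn by (simp add: dist_norm algebra_simps)
  qed
  have S1: "x + a *\<^sub>R u + b *\<^sub>R v \<in> S" if "0 \<le> a" "a \<le> t" "0 \<le> b" "b \<le> t" for a b
    using near[OF that] d3(2) d0(4) by (auto simp: dist_commute subset_iff)
  have S2: "x + a *\<^sub>R v + b *\<^sub>R u \<in> S" if "0 \<le> a" "a \<le> t" "0 \<le> b" "b \<le> t" for a b
    using S1[OF that(3,4,1,2)] by (simp add: algebra_simps)
  obtain a b where ab: "0 < a" "a < t" "0 < b" "b < t"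
    "f (x + t *\<^sub>R u + t *\<^sub>R v) - f (x + t *\<^sub>R u) - f (x + t *\<^sub>R v) + f x
       = t * (t * ?Q (x + a *\<^sub>R u + b *\<^sub>R v))"
    using second_difference_mean_value[OF f assms(2) t S1] by blast
  obtain a' b' where ab': "0 < a'" "a' < t" "0 < b'" "b' < t"
    "f (x + t *\<^sub>R v + t *\<^sub>R u) - f (x + t *\<^sub>R v) - f (x + t *\<^sub>R u) + f x
       = t * (t * ?P (x + a' *\<^sub>R v + b' *\<^sub>R u))"
    using second_difference_mean_value[OF f assms(2) t S2] by blast
  have "t * (t * ?Q (x + a *\<^sub>R u + b *\<^sub>R v)) = t * (t * ?P (x + b' *\<^sub>R u + a' *\<^sub>R v))"
    using ab(5) ab'(5) by (simp add: algebra_simps)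
  then have "?Q (x + a *\<^sub>R u + b *\<^sub>R v) = ?P (x + b' *\<^sub>R u + a' *\<^sub>R v)" using t by simp
  moreover have "\<bar>?Q (x + a *\<^sub>R u + b *\<^sub>R v) - ?Q x\<bar> < e" "\<bar>?P (x + b' *\<^sub>R u + a' *\<^sub>R v) - ?P x\<bar> < e"
    using near[of a b] near[of b' a'] ab ab' d0 by (auto intro!: d)
  \<comment> \<open>The common value cannot lie within half the gap of both limits.\<close>
  moreover have "\<not> (\<bar>y - q\<bar> < \<bar>p - q\<bar> / 2 \<and> \<bar>y - p\<bar> < \<bar>p - q\<bar> / 2)" for p q y :: real
    by (auto simp: abs_if split: if_splits)
  ultimately show False unfolding e_def by metis
qed

lemma dird_commute:
  fixes f :: "'a::euclidean_space \<Rightarrow> 'b::euclidean_space"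
  assumes f: "smooth_on S f" and "open S" "x \<in> S"
  shows "dird u (dird v f) x = dird v (dird u f) x"
proof (rule euclidean_eqI)
  fix b :: 'b
  have 1: "smooth_on S (\<lambda>y. f y \<bullet> b)"
    using smooth_on_compose_linear[OF assms(2) bounded_linear_inner_left f] .
  have inner: "dird v (\<lambda>y. g y \<bullet> b) y = dird v g y \<bullet> b" if "smooth_on S g" "y \<in> S" for g y v
    by (intro dird_eq has_derivative_inner_left smooth_on_has_derivative[OF that])
  have "dird u (dird v f) x \<bullet> b = dird u (dird v (\<lambda>y. f y \<bullet> b)) x" for u v
  proof -
    have "dird u (dird v f) x \<bullet> b = dird u (\<lambda>y. dird v f y \<bullet> b) x"
      using inner[OF smooth_on_dird[OF f] assms(3)] by simp
    also have "\<dots> = dird u (dird v (\<lambda>y. f y \<bullet> b)) x"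
      using differentiable_cong_open(2)[OF assms(2,3), of "dird v (\<lambda>y. f y \<bullet> b)" "\<lambda>y. dird v f y \<bullet> b"]
        inner[OF f] smooth_on_differentiable[OF smooth_on_dird[OF 1] assms(3)] by simp
    finally show ?thesis .
  qed
  then show "dird u (dird v f) x \<bullet> b = dird v (dird u f) x \<bullet> b"
    using dird_commute_real[OF 1 assms(2,3)] by simp
qed

subsection \<open>Connections given by Christoffel fields\<close>

text \<open>The connection whose Christoffel symbols in the coordinates of the chart are
  \<Gamma>.\<close>

definition conn_of ::
  "(real ^ 'n \<Rightarrow> real ^ 'n \<Rightarrow> real ^ 'n \<Rightarrow> real ^ 'n) \<Rightarrow>
   ('n::finite) vfield \<Rightarrow> 'n vfield \<Rightarrow> 'n vfield" where
  "conn_of \<Gamma> Y Z x = dird (Y x) Z x + \<Gamma> x (Y x) (Z x)"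

lemma lie_bracket_dird: "lie_bracket X Y p = dird (X p) Y p - dird (Y p) X p"
  by (simp add: lie_bracket_def dird_def)

lemma dird_add:
  assumes "f differentiable (at x)" "g differentiable (at x)"
  shows "dird v (\<lambda>x. f x + g x) x = dird v f x + dird v g x"
  using dird_eq[OF has_derivative_add[OF has_derivative_dird[OF assms(1)] has_derivative_dird[OF assms(2)]]] .

lemma dird_scaleR:
  assumes "g differentiable (at x)" "f differentiable (at x)"
  shows "dird v (\<lambda>x. g x *\<^sub>R f x) x = g x *\<^sub>R dird v f x + dird v g x *\<^sub>R f x"
  using dird_eq[OF has_derivative_scaleR[OF has_derivative_dird[OF assms(1)] has_derivative_dird[OF assms(2)]]] .

lemma dird_linear_compose:
  assumes "bounded_linear L" "f differentiable (at x)"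
  shows "dird v (\<lambda>x. L (f x)) x = L (dird v f x)"
  using dird_eq[OF bounded_linear.has_derivative[OF assms(1) has_derivative_dird[OF assms(2)]]] .

lemma dird_nth: "f differentiable (at x) \<Longrightarrow> dird v (\<lambda>x. f x $ i) x = dird v f x $ i"
  by (rule dird_linear_compose[OF bounded_linear_vec_nth])

lemma smooth_on_nth: "open S \<Longrightarrow> smooth_on S f \<Longrightarrow> smooth_on S (\<lambda>x. f x $ i)"
  by (rule smooth_on_compose_linear[OF _ bounded_linear_vec_nth])

lemma vec_expansion: "(\<Sum>i\<in>UNIV. (v $ i) *\<^sub>R axis i (1::real)) = v"
  using basis_expansion[of v] by (simp add: scalar_mult_eq_scaleR)

lemma linear_vec_expansion:
  fixes f :: "real ^ 'n::finite \<Rightarrow> 'b::real_vector"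
  assumes "linear f"
  shows "f v = (\<Sum>i\<in>UNIV. (v $ i) *\<^sub>R f (axis i 1))"
  by (subst vec_expansion[of v, symmetric])
     (simp add: linear_sum[OF assms] linear_scale[OF assms])

text \<open>The directional derivative contributes the Leibniz term; the \<Gamma> part is linear
  over functions in both fields.\<close>

lemma affine_connection_conn_of:
  assumes U: "open U" and bil: "\<And>x. x \<in> U \<Longrightarrow> bilinear (\<Gamma> x)"
    and smooth: "\<And>Y Z. smooth_on U Y \<Longrightarrow> smooth_on U Z \<Longrightarrow> smooth_on U (\<lambda>x. \<Gamma> x (Y x) (Z x))"
  shows "affine_connection U (conn_of \<Gamma>)"
  unfolding affine_connection_def
proof (intro conjI allI impI ballI)
  fix X Y :: "'a vfield" assume XY: "smooth_on U X" "smooth_on U Y"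
  have "smooth_on U (\<lambda>x. dird (X x) Y x)"
    using smooth_on_dird_along[OF XY(2) smooth_on_bounded_linear[OF U bounded_linear_ident] XY(1) U U] by simp
  from smooth_on_add[OF U this smooth[OF XY]] show "smooth_on U (conn_of \<Gamma> X Y)"
    by (simp add: conn_of_def[abs_def])
next
  fix X X' Y :: "'a vfield" and x assume "smooth_on U X" "smooth_on U X'" and Y: "smooth_on U Y" and x: "x \<in> U"
  show "conn_of \<Gamma> (\<lambda>p. X p + X' p) Y x = conn_of \<Gamma> X Y x + conn_of \<Gamma> X' Y x"
    using linear_add[OF linear_dird[OF smooth_on_differentiable[OF Y x]]] bilinear_ladd[OF bil[OF x]]
    by (simp add: conn_of_def)
next
  fix g :: "real ^ 'a \<Rightarrow> real" and X Y :: "'a vfield" and x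
  assume "smooth_on U g" "smooth_on U X" and Y: "smooth_on U Y" and x: "x \<in> U"
  show "conn_of \<Gamma> (\<lambda>p. g p *\<^sub>R X p) Y x = g x *\<^sub>R conn_of \<Gamma> X Y x"
    using linear_scale[OF linear_dird[OF smooth_on_differentiable[OF Y x]]] bilinear_lmul[OF bil[OF x]]
    by (simp add: conn_of_def scaleR_add_right)
next
  fix X Y Y' :: "'a vfield" and x assume "smooth_on U X" and Y: "smooth_on U Y" "smooth_on U Y'" and x: "x \<in> U"
  show "conn_of \<Gamma> X (\<lambda>p. Y p + Y' p) x = conn_of \<Gamma> X Y x + conn_of \<Gamma> X Y' x"
    using dird_add[OF Y[THEN smooth_on_differentiable[OF _ x]]] bilinear_radd[OF bil[OF x]]
    by (simp add: conn_of_def)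
next
  fix g :: "real ^ 'a \<Rightarrow> real" and X Y :: "'a vfield" and x
  assume g: "smooth_on U g" and "smooth_on U X" and Y: "smooth_on U Y" and x: "x \<in> U"
  show "conn_of \<Gamma> X (\<lambda>p. g p *\<^sub>R Y p) x
      = frechet_derivative g (at x) (X x) *\<^sub>R Y x + g x *\<^sub>R conn_of \<Gamma> X Y x"
    using dird_scaleR[OF g[THEN smooth_on_differentiable[OF _ x]] Y[THEN smooth_on_differentiable[OF _ x]]]
      bilinear_rmul[OF bil[OF x]]
    by (simp add: conn_of_def scaleR_add_right dird_def[symmetric])
qed

text \<open>The directional derivatives cancel against the Lie bracket, leaving the antisymmetric
  part of \<Gamma>.\<close>

lemma torsion_free_conn_of:
  assumes "\<And>x u v. x \<in> U \<Longrightarrow> \<Gamma> x u v = \<Gamma> x v u"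
  shows "torsion_free U (conn_of \<Gamma>)"
  using assms unfolding torsion_free_def conn_of_def lie_bracket_dird by simp

section \<open>Affine connections determined by their values on constant fields\<close>

context
  fixes U :: "(real ^ 'n::finite) set" and D
  assumes U: "open U" and D: "affine_connection U D"
begin

lemmas conn_axioms = D[unfolded affine_connection_def dird_def[symmetric]]

lemmas conn_smooth = conn_axioms[THEN conjunct1, rule_format]
  and conn_add_left = conn_axioms[THEN conjunct2, THEN conjunct1, rule_format]
  and conn_scale_left = conn_axioms[THEN conjunct2, THEN conjunct2, THEN conjunct1, rule_format]
  and conn_add_right =
    conn_axioms[THEN conjunct2, THEN conjunct2, THEN conjunct2, THEN conjunct1, rule_format]
  and conn_scale_right =
    conn_axioms[THEN conjunct2, THEN conjunct2, THEN conjunct2, THEN conjunct2, rule_format]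

lemma conn_sum_left:
  assumes "finite I" "\<And>i. i \<in> I \<Longrightarrow> smooth_on U (g i)" "\<And>i. i \<in> I \<Longrightarrow> smooth_on U (E i)"
    and Y: "smooth_on U Y" and x: "x \<in> U"
  shows "D (\<lambda>p. \<Sum>i\<in>I. g i p *\<^sub>R E i p) Y x = (\<Sum>i\<in>I. g i x *\<^sub>R D (E i) Y x)"
  using assms(1,2,3)
proof (induction I rule: finite_induct)
  case empty
  show ?case
    \<comment> \<open>The zero field is written as zero times the zero field.\<close>
    using conn_scale_left[OF smooth_on_const[OF U] smooth_on_const[OF U] Y x, of 0 0] by simp
next
  case (insert i I)
  have "smooth_on U (\<lambda>p. g i p *\<^sub>R E i p)"
    using insert.prems by (intro smooth_on_scaleR[OF U]) auto
  moreover have "smooth_on U (\<lambda>p. \<Sum>i\<in>I. g i p *\<^sub>R E i p)"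
    using insert.prems by (intro smooth_on_sum[OF U] smooth_on_scaleR[OF U]) auto
  ultimately show ?case
    using insert conn_add_left[OF _ _ Y x] conn_scale_left[OF _ _ Y x] by simp
qed

lemma conn_sum_right:
  assumes "finite I" "\<And>i. i \<in> I \<Longrightarrow> smooth_on U (g i)" "\<And>i. i \<in> I \<Longrightarrow> smooth_on U (E i)"
    and X: "smooth_on U X" and x: "x \<in> U"
  shows "D X (\<lambda>p. \<Sum>i\<in>I. g i p *\<^sub>R E i p) x
    = (\<Sum>i\<in>I. dird (X x) (g i) x *\<^sub>R E i x + g i x *\<^sub>R D X (E i) x)"
  using assms(1,2,3)
proof (induction I rule: finite_induct)
  case empty
  show ?case
    \<comment> \<open>The zero field is written as the sum of two zero fields, so its covariant
      derivative equals its own double.\<close>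
    using conn_add_right[OF X smooth_on_const[OF U] smooth_on_const[OF U] x, of 0 0] by simp
next
  case (insert i I)
  have "smooth_on U (\<lambda>p. g i p *\<^sub>R E i p)"
    using insert.prems by (intro smooth_on_scaleR[OF U]) auto
  moreover have "smooth_on U (\<lambda>p. \<Sum>i\<in>I. g i p *\<^sub>R E i p)"
    using insert.prems by (intro smooth_on_sum[OF U] smooth_on_scaleR[OF U]) auto
  ultimately show ?case
    using insert conn_add_right[OF X _ _ x] conn_scale_right[OF _ X _ x] by simp
qed

text \<open>These values are the Christoffel symbols. The Leibniz term vanishes for constant
  factors, leaving homogeneity in the second field.\<close>

lemma bilinear_conn_const:
  assumes "x \<in> U"
  shows "bilinear (\<lambda>u v. D (\<lambda>_. u) (\<lambda>_. v) x)"
proof -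
  note c = smooth_on_const[OF U]
  have "dird u (\<lambda>_. r) x = 0" for u :: "real ^ 'n" and r :: real
    using dird_eq[OF has_derivative_const] by metis
  then show ?thesis
    using conn_add_left[OF c c c assms] conn_scale_left[OF c c c assms]
      conn_add_right[OF c c c assms] conn_scale_right[OF c c c assms]
    by (auto simp: bilinear_def intro!: linearI)
qed

text \<open>Both fields are expanded in the coordinate frame: the first expands linearly over
  functions, and the second adds the derivatives of its components.\<close>

lemma conn_eq_conn_of:
  assumes "smooth_on U Y" "smooth_on U Z" "x \<in> U"
  shows "D Y Z x = conn_of (\<lambda>x u v. D (\<lambda>_. u) (\<lambda>_. v) x) Y Z x"
proof -
  note c = smooth_on_const[OF U]
  note bil = bilinear_conn_const[OF assms(3)]
  have 1: "D Y (\<lambda>_. v) x = D (\<lambda>_. Y x) (\<lambda>_. v) x" for v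
  proof -
    have "D (\<lambda>p. \<Sum>i\<in>UNIV. Y p $ i *\<^sub>R axis i 1) (\<lambda>_. v) x
        = (\<Sum>i\<in>UNIV. Y x $ i *\<^sub>R D (\<lambda>_. axis i 1) (\<lambda>_. v) x)"
      using conn_sum_left[where g = "\<lambda>i p. Y p $ i" and E = "\<lambda>i _. axis i 1", OF finite
          smooth_on_nth[OF U assms(1)] c c assms(3)] .
    also have "\<dots> = D (\<lambda>_. Y x) (\<lambda>_. v) x"
      using linear_vec_expansion[of "\<lambda>u. D (\<lambda>_. u) (\<lambda>_. v) x" "Y x"] bil
      by (simp add: bilinear_def)
    finally show ?thesis by (simp add: vec_expansion)
  qed
  have "D Y (\<lambda>p. \<Sum>i\<in>UNIV. Z p $ i *\<^sub>R axis i 1) x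
      = (\<Sum>i\<in>UNIV. dird (Y x) (\<lambda>p. Z p $ i) x *\<^sub>R axis i 1 + Z x $ i *\<^sub>R D Y (\<lambda>_. axis i 1) x)"
    using conn_sum_right[where g = "\<lambda>i p. Z p $ i" and E = "\<lambda>i _. axis i 1", OF finite
        smooth_on_nth[OF U assms(2)] c assms(1,3)] .
  also have "\<dots> = dird (Y x) Z x + D (\<lambda>_. Y x) (\<lambda>_. Z x) x"
    using linear_vec_expansion[of "\<lambda>v. D (\<lambda>_. Y x) (\<lambda>_. v) x" "Z x"] bil
    by (simp add: bilinear_def sum.distrib dird_nth[OF smooth_on_differentiable[OF assms(2,3)]]
        vec_expansion 1)
  finally show ?thesis by (simp add: vec_expansion conn_of_def)
qed

end

section \<open>Curvature in coordinates\<close>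

lemma bilinear_Basis:
  fixes h :: "'a::euclidean_space \<Rightarrow> 'b::euclidean_space \<Rightarrow> 'c::real_vector"
  assumes "bilinear h"
  shows "h u v = (\<Sum>(i,j)\<in>Basis \<times> Basis. ((u \<bullet> i) * (v \<bullet> j)) *\<^sub>R h i j)"
proof -
  have "h u v = h (\<Sum>i\<in>Basis. (u \<bullet> i) *\<^sub>R i) (\<Sum>j\<in>Basis. (v \<bullet> j) *\<^sub>R j)"
    by (simp only: euclidean_representation)
  also have "\<dots> = (\<Sum>(i,j)\<in>Basis \<times> Basis. ((u \<bullet> i) * (v \<bullet> j)) *\<^sub>R h i j)"
    unfolding bilinear_sum[OF assms]
    by (intro sum.cong) (auto simp: bilinear_lmul[OF assms] bilinear_rmul[OF assms] mult.commute)
  finally show ?thesis .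
qed

text \<open>A product rule with three factors, since the bilinear map itself depends on the point.
  Expansion in basis pairs turns it into scalar coefficients times the fields
  \<open>\<Gamma> x i j\<close>.\<close>

lemma bilinear_field_has_derivative:
  fixes \<Gamma> :: "'a::euclidean_space \<Rightarrow> 'b::euclidean_space \<Rightarrow> 'c::euclidean_space \<Rightarrow> 'd::real_normed_vector"
  assumes U: "open U" "p \<in> U" and bil: "\<And>x. x \<in> U \<Longrightarrow> bilinear (\<Gamma> x)"
    and diff: "\<And>u v. (\<lambda>x. \<Gamma> x u v) differentiable (at p)"
    and Y: "(Y has_derivative Y') (at p)" and Z: "(Z has_derivative Z') (at p)"
  shows "((\<lambda>x. \<Gamma> x (Y x) (Z x)) has_derivative
    (\<lambda>w. dird w (\<lambda>x. \<Gamma> x (Y p) (Z p)) p + \<Gamma> p (Y' w) (Z p) + \<Gamma> p (Y p) (Z' w))) (at p)"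
proof -
  let ?I = "Basis \<times> Basis :: ('b \<times> 'c) set"
  have *: "((\<lambda>x. \<Gamma> x (Y x) (Z x)) has_derivative
     (\<lambda>w. \<Sum>k\<in>?I. ((Y p \<bullet> fst k) * (Z p \<bullet> snd k)) *\<^sub>R dird w (\<lambda>x. \<Gamma> x (fst k) (snd k)) p
       + ((Y p \<bullet> fst k) * (Z' w \<bullet> snd k) + (Y' w \<bullet> fst k) * (Z p \<bullet> snd k)) *\<^sub>R \<Gamma> p (fst k) (snd k))) (at p)"
    if Y: "(Y has_derivative Y') (at p)" and Z: "(Z has_derivative Z') (at p)" for Y Y' Z Z'
  proof -
    have "((\<lambda>x. \<Sum>k\<in>?I. ((Y x \<bullet> fst k) * (Z x \<bullet> snd k)) *\<^sub>R \<Gamma> x (fst k) (snd k)) has_derivative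
     (\<lambda>w. \<Sum>k\<in>?I. ((Y p \<bullet> fst k) * (Z p \<bullet> snd k)) *\<^sub>R dird w (\<lambda>x. \<Gamma> x (fst k) (snd k)) p
       + ((Y p \<bullet> fst k) * (Z' w \<bullet> snd k) + (Y' w \<bullet> fst k) * (Z p \<bullet> snd k)) *\<^sub>R \<Gamma> p (fst k) (snd k))) (at p)"
      by (intro has_derivative_sum has_derivative_scaleR has_derivative_mult has_derivative_inner_left Y Z
          has_derivative_dird diff)
    then show ?thesis
      by (rule has_derivative_transform_within_open[OF _ U])
         (use bilinear_Basis[OF bil] in \<open>simp add: split_def\<close>)
  qed
  \<comment> \<open>Constant arguments isolate the part of the sum in which only \<Gamma> is
    differentiated.\<close>
  have 0: "dird w (\<lambda>x. \<Gamma> x (Y p) (Z p)) p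
      = (\<Sum>k\<in>?I. ((Y p \<bullet> fst k) * (Z p \<bullet> snd k)) *\<^sub>R dird w (\<lambda>x. \<Gamma> x (fst k) (snd k)) p)" for w
    using dird_eq[OF *[of "\<lambda>_. Y p" "\<lambda>_. 0" "\<lambda>_. Z p" "\<lambda>_. 0"]] by simp
  show ?thesis
    by (rule has_derivative_eq_rhs[OF *[OF Y Z]])
       (simp add: 0 bilinear_Basis[OF bil[OF U(2)], of "Y' _" "Z p"]
         bilinear_Basis[OF bil[OF U(2)], of "Y p" "Z' _"] split_def sum.distrib scaleR_add_left algebra_simps)
qed

text \<open>Second derivatives of \<open>Z\<close> cancel by symmetry, the terms with a derivative
  of \<open>X\<close> or \<open>Y\<close> are absorbed by the bracket, and those with a first
  derivative of \<open>Z\<close> inside \<Gamma> cancel in pairs.\<close>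

lemma curvature_conn_of:
  fixes \<Gamma> :: "real ^ 'n::finite \<Rightarrow> real ^ 'n \<Rightarrow> real ^ 'n \<Rightarrow> real ^ 'n"
  assumes U: "open U" "p \<in> U" and bil: "\<And>x. x \<in> U \<Longrightarrow> bilinear (\<Gamma> x)"
    and diff: "\<And>u v. (\<lambda>x. \<Gamma> x u v) differentiable (at p)"
    and sym: "\<And>u v. \<Gamma> p u v = \<Gamma> p v u"
    and X: "smooth_on U X" and Y: "smooth_on U Y" and Z: "smooth_on U Z"
  shows "curvature (conn_of \<Gamma>) X Y Z p
    = dird (X p) (\<lambda>x. \<Gamma> x (Y p) (Z p)) p - dird (Y p) (\<lambda>x. \<Gamma> x (X p) (Z p)) p
      + \<Gamma> p (X p) (\<Gamma> p (Y p) (Z p)) - \<Gamma> p (Y p) (\<Gamma> p (X p) (Z p))"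
proof -
  have second: "dird w (conn_of \<Gamma> Y Z) p
      = dird w (dird (Y p) Z) p + dird (dird w Y p) Z p + (dird w (\<lambda>x. \<Gamma> x (Y p) (Z p)) p
        + \<Gamma> p (dird w Y p) (Z p) + \<Gamma> p (Y p) (dird w Z p))"
    if Y: "smooth_on U Y" for w Y
  proof -
    note dY = smooth_on_has_derivative[OF Y U(2)] and dZ = smooth_on_has_derivative[OF Z U(2)]
    have "((\<lambda>x. dird (Y x) Z x + \<Gamma> x (Y x) (Z x)) has_derivative
      (\<lambda>w. (dird w (dird (Y p) Z) p + dird (dird w Y p) Z p) + (dird w (\<lambda>x. \<Gamma> x (Y p) (Z p)) p
        + \<Gamma> p (dird w Y p) (Z p) + \<Gamma> p (Y p) (dird w Z p)))) (at p)"
      by (intro has_derivative_add has_derivative_dird_along[OF Z U has_derivative_ident dY]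
          bilinear_field_has_derivative[OF U bil diff dY dZ])
    from dird_eq[OF this] show ?thesis by (simp add: conn_of_def[abs_def])
  qed
  note lin = linear_diff[OF linear_dird[OF smooth_on_differentiable[OF Z U(2)]]]
  show ?thesis
    unfolding curvature_def conn_of_def[of \<Gamma> X "conn_of \<Gamma> Y Z"] conn_of_def[of \<Gamma> Y "conn_of \<Gamma> X Z"]
      conn_of_def[of \<Gamma> "lie_bracket X Y"] second[OF X] second[OF Y] lie_bracket_dird lin
      bilinear_lsub[OF bil[OF U(2)]] conn_of_def[of \<Gamma> Y Z] conn_of_def[of \<Gamma> X Z]
      bilinear_radd[OF bil[OF U(2)]] dird_commute[OF Z U, of "X p" "Y p"]
    by (simp add: algebra_simps)
qed

subsection \<open>The geometry of a deformed group\<close>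

lemma frechet_derivative_dird: "frechet_derivative f (at x) v = dird v f x"
  by (simp add: dird_def)

lemma jacobian_mult_vec:
  fixes f :: "real ^ 'n::finite \<Rightarrow> real ^ 'm::finite"
  assumes "(f has_derivative f') (at x)"
  shows "jacobian f (at x) *v v = f' v"
  using assms has_derivative_linear[OF assms] frechet_derivative_at[OF assms]
  by (simp add: jacobian_def)

lemma matrix_entry_mult_axis:
  fixes M :: "real ^ 'n::finite ^ 'm"
  shows "M $ i $ j = (M *v axis j 1) $ i"
  by (simp add: matrix_vector_mult_basis column_def)

text \<open>\<open>matrix_inv\<close> is defined by choice, so a two-sided inverse must first exist;
  for a square matrix a left inverse is one.\<close>

lemma matrix_inv_mult_vec:
  fixes M :: "real ^ 'n::finite ^ 'n"
  assumes "linear g" "\<And>v. g (M *v v) = v"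
  shows "matrix_inv M *v v = g v"
proof -
  have 1: "matrix g ** M = mat 1"
    using assms by (simp add: matrix_eq matrix_vector_mul_assoc[symmetric])
  then have "\<exists>N. M ** N = mat 1 \<and> N ** M = mat 1"
    using matrix_left_right_inverse by blast
  then have "M ** matrix_inv M = mat 1"
    unfolding matrix_inv_def by (metis (mono_tags, lifting) someI_ex)
  then have "matrix_inv M = matrix g"
    using 1 by (metis matrix_mul_assoc matrix_mul_lid matrix_mul_rid)
  then show ?thesis using assms by simp
qed

lemma slice_has_derivative:
  fixes \<Phi> :: "'a::real_normed_vector \<times> 'b::real_normed_vector \<Rightarrow> 'c::real_normed_vector"
  assumes "smooth_on (U \<times> UNIV) \<Phi>" "x \<in> U" "(g has_derivative g') (at t)"
  shows "((\<lambda>t. \<Phi> (x, g t)) has_derivative (\<lambda>v. dird (0, g' v) \<Phi> (x, g t))) (at t)"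
  by (rule has_derivative_compose[OF has_derivative_Pair[OF has_derivative_const assms(3)]
        smooth_on_has_derivative[OF assms(1)]]) (use assms(2) in simp)

locale deformed =
  fixes U :: "(real ^ 'n::finite) set" and H K :: "real ^ 'n \<Rightarrow> real ^ 'n \<Rightarrow> real ^ 'n"
  assumes open_U: "open U" and deformation: "deformation U H"
    and deformation_inverse: "deformation_inverse U H K"
begin

text \<open>Uncurried forms of \<open>H\<close> and \<open>K\<close>: partial derivatives become
  directional derivatives along \<open>(u, 0)\<close> for the point and \<open>(0, v)\<close> for
  the parameter.\<close>

definition F :: "(real ^ 'n) \<times> (real ^ 'n) \<Rightarrow> real ^ 'n" where "F = (\<lambda>(x, s). H x s)"
definition G :: "(real ^ 'n) \<times> (real ^ 'n) \<Rightarrow> real ^ 'n" where "G = (\<lambda>(x, t). K x t)"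

text \<open>\<open>A x\<close> is the linear map of \<open>h_mat H x\<close> and \<open>B x\<close>
  its inverse, so \<open>christoffel\<close> carries the second parameter derivative of
  \<open>H\<close> at 0 back to coordinate vectors.\<close>

definition A where "A x v = dird (0, v) F (x, 0)"
definition B where "B x v = dird (0, v) G (x, 0)"
definition C where "C x u v = dird (0, u) (dird (0, v) F) (x, 0)"
definition christoffel where "christoffel x u v = B x (C x u v)"

lemma F_smooth: "smooth_on (U \<times> UNIV) F" and G_smooth: "smooth_on (U \<times> UNIV) G"
  and F_0: "x \<in> U \<Longrightarrow> F (x, 0) = 0" and GF: "x \<in> U \<Longrightarrow> G (x, F (x, s)) = s"
  using deformation deformation_inverse by (auto simp: deformation_def deformation_inverse_def F_def G_def)

lemma G_0: "x \<in> U \<Longrightarrow> G (x, 0) = 0"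
  using GF[of x 0] F_0 by simp

lemma open_UT: "open (U \<times> (UNIV :: (real ^ 'n) set))"
  by (simp add: open_U open_Times)

lemmas diffF = smooth_on_differentiable[OF F_smooth] and diffG = smooth_on_differentiable[OF G_smooth]

lemmas slice_derivative = slice_has_derivative[OF _ _ has_derivative_ident]

lemma slice_continuous:
  assumes "smooth_on (U \<times> UNIV) \<Phi>" "x \<in> U"
  shows "continuous_on UNIV (\<lambda>t. \<Phi> (x, t))"
  using has_derivative_continuous[OF slice_derivative[OF assms]]
  by (simp add: continuous_at_imp_continuous_on)

text \<open>\<open>K\<close> is given only as a left inverse. The range of \<open>H x\<close> is
  open by invariance of domain, and closed as the set where \<open>H x\<close> after
  \<open>K x\<close> is the identity; the space is connected.\<close>

lemma F_surj:
  assumes "x \<in> U"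
  shows "\<exists>s. F (x, s) = t"
proof -
  let ?R = "range (\<lambda>s. F (x, s))"
  have cF: "continuous_on UNIV (\<lambda>s. F (x, s))" and cG: "continuous_on UNIV (\<lambda>s. G (x, s))"
    using slice_continuous F_smooth G_smooth assms by blast+
  have "inj (\<lambda>s. F (x, s))" using GF[OF assms] by (intro injI) metis
  then have "open ?R" using invariance_of_domain[OF cF] by simp
  moreover have "?R = {t. F (x, G (x, t)) = t}" using GF[OF assms] by (auto simp: image_iff) metis
  then have "closed ?R"
    using continuous_on_compose2[OF cF cG] by (auto intro!: closed_Collect_eq)
  ultimately have "?R = UNIV" using clopen[of ?R] by auto
  then show ?thesis by (metis UNIV_I imageE)
qed

lemma FG: "x \<in> U \<Longrightarrow> F (x, G (x, t)) = t"
  using F_surj[of x t] GF[of x] by auto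

lemma linear_A: "x \<in> U \<Longrightarrow> linear (A x)" and linear_B: "x \<in> U \<Longrightarrow> linear (B x)"
  unfolding A_def B_def
  using has_derivative_linear[OF slice_derivative[OF F_smooth]]
    has_derivative_linear[OF slice_derivative[OF G_smooth]] by blast+

lemma BA: assumes "x \<in> U" shows "B x (A x v) = v"
proof -
  have "((\<lambda>s. G (x, F (x, s))) has_derivative (\<lambda>v. B x (A x v))) (at 0)"
    using slice_has_derivative[OF G_smooth assms slice_derivative[OF F_smooth assms]] F_0[OF assms]
    unfolding A_def B_def by metis
  moreover have "((\<lambda>s. G (x, F (x, s))) has_derivative (\<lambda>v. v)) (at 0)"
    by (simp add: GF[OF assms])
  ultimately show ?thesis using has_derivative_unique by metis
qed

lemma AB: assumes "x \<in> U" shows "A x (B x v) = v"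
proof -
  have "((\<lambda>s. F (x, G (x, s))) has_derivative (\<lambda>v. A x (B x v))) (at 0)"
    using slice_has_derivative[OF F_smooth assms slice_derivative[OF G_smooth assms]] G_0[OF assms]
    unfolding A_def B_def by metis
  moreover have "((\<lambda>s. F (x, G (x, s))) has_derivative (\<lambda>v. v)) (at 0)"
    by (simp add: FG[OF assms])
  ultimately show ?thesis using has_derivative_unique by metis
qed

lemma vielbein_eq: assumes "x \<in> U" shows "vielbein H m x = B x (axis m 1)"
proof -
  have "(H x has_derivative A x) (at 0)"
    using slice_derivative[OF F_smooth assms] by (simp add: F_def A_def[abs_def])
  then have "matrix_inv (h_mat H x) *v v = B x v" for v
    unfolding h_mat_def
    by (intro matrix_inv_mult_vec linear_B assms) (simp add: jacobian_mult_vec BA assms)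
  then show ?thesis by (simp add: vielbein_def matrix_vector_mult_basis[symmetric])
qed

lemma field_of_comps_eq: "x \<in> U \<Longrightarrow> field_of_comps H \<tau> x = B x (\<tau> x)"
  using linear_vec_expansion[OF linear_B, of x "\<tau> x"] by (simp add: field_of_comps_def vielbein_eq)

lemma smooth_Pair_const: "smooth_on U f \<Longrightarrow> smooth_on U (\<lambda>x. (c, f x))"
  by (rule smooth_on_Pair[OF open_U smooth_on_const[OF open_U]])

lemma smooth_slice_0: "smooth_on U (\<lambda>x. (x, 0))"
  by (rule smooth_on_Pair[OF open_U smooth_on_bounded_linear[OF open_U bounded_linear_ident]
        smooth_on_const[OF open_U]])

lemma smooth_B: "smooth_on U \<tau> \<Longrightarrow> smooth_on U (\<lambda>x. B x (\<tau> x))"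
  unfolding B_def
  by (rule smooth_on_dird_along[OF G_smooth smooth_slice_0 smooth_Pair_const open_U open_UT]) auto

lemma smooth_vielbein: "smooth_on U (vielbein H m)"
  using smooth_B[OF smooth_on_const[OF open_U]] smooth_on_cong[OF open_U, of "vielbein H m"] vielbein_eq
  by (metis (mono_tags, lifting))

lemma smooth_field_of_comps: "smooth_on U \<tau> \<Longrightarrow> smooth_on U (field_of_comps H \<tau>)"
  using smooth_B smooth_on_cong[OF open_U, of "field_of_comps H \<tau>"] field_of_comps_eq
  by (metis (mono_tags, lifting))

lemma smooth_christoffel:
  assumes "smooth_on U Y" "smooth_on U Z"
  shows "smooth_on U (\<lambda>x. christoffel x (Y x) (Z x))"
proof -
  have "smooth_on U (\<lambda>x. C x (Y x) (Z x))"
    unfolding C_def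
    by (rule smooth_on_dird_dird_along[OF F_smooth smooth_slice_0 smooth_Pair_const[OF assms(1)]
          smooth_Pair_const[OF assms(2)] open_U open_UT]) auto
  then show ?thesis unfolding christoffel_def by (rule smooth_B)
qed

text \<open>Second derivatives commute; this is the source of vanishing torsion.\<close>

lemma christoffel_sym: "x \<in> U \<Longrightarrow> christoffel x u v = christoffel x v u"
  using dird_commute[OF F_smooth open_UT, of "(x, 0)" "(0, u)" "(0, v)"]
  by (simp add: christoffel_def C_def)

lemma A_christoffel: "x \<in> U \<Longrightarrow> A x (christoffel x u v) = C x u v"
  by (simp add: christoffel_def AB)

lemma bilinear_C: assumes "x \<in> U" shows "bilinear (C x)"
proof -
  note bil = bilinear_dird_dird[OF F_smooth open_UT, of "(x, 0)"]
  have pair: "(0 :: real ^ 'n, u + v) = (0, u) + (0, v)" "(0 :: real ^ 'n, r *\<^sub>R v) = r *\<^sub>R (0, v)"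
    for r and u v :: "real ^ 'n" by simp_all
  show ?thesis
    unfolding bilinear_def C_def
    using assms bilinear_ladd[OF bil] bilinear_radd[OF bil] bilinear_lmul[OF bil] bilinear_rmul[OF bil]
    by (auto intro!: linearI simp only: pair mem_Times_iff UNIV_I fst_conv snd_conv simp_thms)
qed

lemma bilinear_christoffel: "x \<in> U \<Longrightarrow> bilinear (christoffel x)"
  using bilinear_C[of x] linear_compose[OF _ linear_B, of _ x]
  by (auto simp: bilinear_def christoffel_def[abs_def] o_def)

abbreviation conn where "conn \<equiv> conn_of christoffel"

lemma affine_conn: "affine_connection U conn"
  by (rule affine_connection_conn_of[OF open_U bilinear_christoffel smooth_christoffel])

lemma torsion_free_conn: "torsion_free U conn"
  by (rule torsion_free_conn_of[OF christoffel_sym])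

section \<open>The multiplication law, parallel transport and the coefficients of the
  connection\<close>

abbreviation \<phi> where "\<phi> \<equiv> mult_fun H K"

lemma act_fun_G: "act_fun K x t = x + G (x, t)"
  by (simp add: act_fun_def G_def)

lemma mult_fun_eq: "\<phi> x t t' = F (x, G (x, t) + G (x + G (x, t), t'))"
  by (simp add: mult_fun_def F_def G_def act_fun_def)

text \<open>The chain rule in the second parameter at 0, where \<open>K\<close> vanishes at the
  moved point; that point must lie in the chart.\<close>

lemma lambda_mat_mult:
  assumes "x \<in> U" "x + G (x, t) \<in> U"
  shows "lambda_mat \<phi> x t *v v = dird (0, B (x + G (x, t)) v) F (x, G (x, t))"
proof -
  have "((\<lambda>t'. G (x, t) + G (x + G (x, t), t')) has_derivative B (x + G (x, t))) (at 0)"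
    unfolding B_def using has_derivative_add[OF has_derivative_const slice_derivative[OF G_smooth assms(2)]]
    by simp
  from jacobian_mult_vec[OF slice_has_derivative[OF F_smooth assms(1) this]]
  show ?thesis unfolding lambda_mat_def mult_fun_eq by (simp add: G_0[OF assms(2)])
qed

text \<open>The parameters whose action keeps \<open>x\<close> in the chart form a neighbourhood of
  0, so formulas valid only there can still be differentiated at 0.\<close>

lemma open_small: "x \<in> U \<Longrightarrow> open {t. x + G (x, t) \<in> U}"
  using open_vimage[OF open_U continuous_on_add[OF continuous_on_const slice_continuous[OF G_smooth]]]
  by (simp add: vimage_def)

text \<open>With \<open>Z\<close> the field of components \<tau>, transport is the parameter
  derivative of \<open>H\<close> along the value of \<open>Z\<close> at the moved point. Moving the
  base gives the \<open>C\<close> term, moving \<open>Z\<close> gives the \<open>A\<close> term, and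
  together they are \<open>A x\<close> of the covariant derivative of \<open>Z\<close>.\<close>

lemma lambda_transport:
  assumes x: "x \<in> U" and \<tau>: "smooth_on U \<tau>"
  shows "((\<lambda>t. lambda_mat \<phi> x t *v \<tau> (x + G (x, t))) has_derivative
      (\<lambda>u. A x (conn (\<lambda>_. B x u) (field_of_comps H \<tau>) x))) (at 0)"
proof -
  let ?Z = "\<lambda>x. B x (\<tau> x)"
  have g: "((\<lambda>t. G (x, t)) has_derivative B x) (at 0)"
    using slice_derivative[OF G_smooth x] by (simp add: B_def[abs_def])
  have "((\<lambda>t. x + G (x, t)) has_derivative B x) (at 0)"
    using has_derivative_add[OF has_derivative_const g] by simp
  moreover have Z: "smooth_on U ?Z" by (rule smooth_B[OF \<tau>])
  then have "(?Z has_derivative (\<lambda>v. dird v ?Z x)) (at (x + G (x, 0)))"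
    using smooth_on_has_derivative[OF Z x] by (simp add: G_0[OF x])
  ultimately have w: "((\<lambda>t. ?Z (x + G (x, t))) has_derivative (\<lambda>u. dird (B x u) ?Z x)) (at 0)"
    by (rule has_derivative_compose)
  have "((\<lambda>t. dird (0, ?Z (x + G (x, t))) F (x, G (x, t))) has_derivative
      (\<lambda>u. dird (0, B x u) (dird (0, ?Z (x + G (x, 0))) F) (x, G (x, 0))
        + dird (0, dird (B x u) ?Z x) F (x, G (x, 0)))) (at 0)"
    by (rule has_derivative_dird_along[OF F_smooth open_UT _
          has_derivative_Pair[OF has_derivative_const g] has_derivative_Pair[OF has_derivative_const w]])
       (simp add: x)
  then have "((\<lambda>t. dird (0, ?Z (x + G (x, t))) F (x, G (x, t))) has_derivative
      (\<lambda>u. C x (B x u) (?Z x) + A x (dird (B x u) ?Z x))) (at 0)"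
    by (simp add: G_0[OF x] A_def C_def)
  then have 1: "((\<lambda>t. lambda_mat \<phi> x t *v \<tau> (x + G (x, t))) has_derivative
      (\<lambda>u. C x (B x u) (?Z x) + A x (dird (B x u) ?Z x))) (at 0)"
    by (rule has_derivative_transform_within_open[OF _ open_small[OF x]])
       (use x in \<open>simp_all add: G_0 lambda_mat_mult\<close>)
  have "dird v (field_of_comps H \<tau>) x = dird v ?Z x" for v
    by (rule dird_cong[OF open_U x field_of_comps_eq
          smooth_on_differentiable[OF smooth_field_of_comps[OF \<tau>] x]])
  then have "C x (B x u) (?Z x) + A x (dird (B x u) ?Z x)
      = A x (conn (\<lambda>_. B x u) (field_of_comps H \<tau>) x)" for u
    by (simp add: conn_of_def field_of_comps_eq[OF x] linear_add[OF linear_A[OF x]] A_christoffel[OF x])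
  with 1 show ?thesis by simp
qed

lemma field_of_comps_axis: "field_of_comps H (\<lambda>_. axis k 1) = vielbein H k"
  by (rule ext) (simp add: field_of_comps_def axis_def if_distrib[of "\<lambda>r. r *\<^sub>R _"] cong: if_cong)

text \<open>Constant components \<open>axis n 1\<close> describe the frame field with index
  \<open>n\<close>, and transport then reads off column \<open>n\<close> of the matrix
  \<lambda>.\<close>

lemma gamma_coeff_eq:
  assumes "x \<in> U"
  shows "gamma_coeff \<phi> x m k n = A x (conn (vielbein H k) (vielbein H n) x) $ m"
proof -
  have "((\<lambda>t. lambda_mat \<phi> x t $ m $ n) has_derivative
      (\<lambda>u. A x (conn (\<lambda>_. B x u) (vielbein H n) x) $ m)) (at 0)"
    using bounded_linear.has_derivative[OF bounded_linear_vec_nth, OF lambda_transport[OF assms smooth_on_const[OF open_U], of "axis n 1"]]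
    by (simp add: matrix_entry_mult_axis[symmetric] field_of_comps_axis)
  from dird_eq[OF this] show ?thesis
    by (simp add: gamma_coeff_def partial_at_def frechet_derivative_dird conn_of_def vielbein_eq[OF assms])
qed

lemma vielbein_sum: "x \<in> U \<Longrightarrow> (\<Sum>m\<in>UNIV. (A x v $ m) *\<^sub>R vielbein H m x) = v"
  using linear_vec_expansion[OF linear_B, of x "A x v"] by (simp add: BA vielbein_eq)

lemma conn_vielbein:
  "x \<in> U \<Longrightarrow> conn (vielbein H n) (vielbein H k) x
     = (\<Sum>m\<in>UNIV. gamma_coeff \<phi> x m n k *\<^sub>R vielbein H m x)"
  by (simp add: gamma_coeff_eq vielbein_sum)

text \<open>Without torsion the bracket is the antisymmetrized covariant derivative, hence the
  antisymmetrized \<gamma>.\<close>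

lemma lie_bracket_vielbein:
  "x \<in> U \<Longrightarrow> lie_bracket (vielbein H k) (vielbein H l) x
     = (\<Sum>m\<in>UNIV. structure_fun \<phi> x m k l *\<^sub>R vielbein H m x)"
  using torsion_free_conn smooth_vielbein[of k] smooth_vielbein[of l]
  unfolding torsion_free_def
  by (simp add: structure_fun_def scaleR_diff_left sum_subtractf conn_vielbein[symmetric])

text \<open>The Leibniz rule for a combination of frame fields; applying \<open>A x\<close> extracts
  frame components.\<close>

lemma cov_deriv_eq:
  assumes x: "x \<in> U" and \<tau>: "smooth_on U \<tau>"
  shows "cov_deriv H \<phi> \<tau> n x = A x (conn (vielbein H n) (field_of_comps H \<tau>) x)"
proof -
  note d\<tau> = smooth_on_differentiable[OF \<tau> x]
  note lin = linear_A[OF x]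
  have "conn (vielbein H n) (field_of_comps H \<tau>) x
    = (\<Sum>k\<in>UNIV. dird (vielbein H n x) (\<lambda>x. \<tau> x $ k) x *\<^sub>R vielbein H k x
        + \<tau> x $ k *\<^sub>R conn (vielbein H n) (vielbein H k) x)"
    unfolding field_of_comps_def[abs_def]
    by (rule conn_sum_right[OF open_U affine_conn])
       (auto intro: smooth_on_nth[OF open_U \<tau>] smooth_vielbein x)
  also have "\<dots> = B x (dird (vielbein H n x) \<tau> x) + (\<Sum>k\<in>UNIV. \<tau> x $ k *\<^sub>R conn (vielbein H n) (vielbein H k) x)"
    using linear_vec_expansion[OF linear_B[OF x], of "dird (vielbein H n x) \<tau> x"]
    by (simp add: sum.distrib dird_nth[OF d\<tau>] vielbein_eq[OF x])
  finally have "A x (conn (vielbein H n) (field_of_comps H \<tau>) x) =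
     dird (vielbein H n x) \<tau> x + (\<Sum>k\<in>UNIV. \<tau> x $ k *\<^sub>R A x (conn (vielbein H n) (vielbein H k) x))"
    by (simp add: linear_add[OF lin] linear_sum[OF lin] linear_scale[OF lin] AB[OF x])
  then show ?thesis
    by (simp add: cov_deriv_def vec_eq_iff frechet_derivative_dird dird_nth[OF d\<tau>] gamma_coeff_eq[OF x] mult.commute)
qed

section \<open>The second-order expansion of the multiplication law and the curvature\<close>

lemma dird_along_G:
  assumes x: "x \<in> U" and \<Phi>: "smooth_on (U \<times> UNIV) \<Phi>"
  shows "dird v (\<lambda>t. \<Phi> (x, G (x, t))) t = dird (0, dird (0, v) G (x, t)) \<Phi> (x, G (x, t))"
    and "dird u (\<lambda>t. dird (0, dird (0, v) G (x, t)) \<Phi> (x, G (x, t))) 0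
      = dird (0, B x u) (dird (0, B x v) \<Phi>) (x, 0) + dird (0, dird (0, u) (dird (0, v) G) (x, 0)) \<Phi> (x, 0)"
proof -
  note g = slice_derivative[OF G_smooth x]
  show "dird v (\<lambda>t. \<Phi> (x, G (x, t))) t = dird (0, dird (0, v) G (x, t)) \<Phi> (x, G (x, t))"
    by (rule dird_eq[OF slice_has_derivative[OF \<Phi> x g]])
  \<comment> \<open>In the second derivative along the curve the direction moves too, which brings
    in the second derivative of \<open>K\<close>.\<close>
  have "((\<lambda>t. dird (0, dird (0, v) G (x, t)) \<Phi> (x, G (x, t))) has_derivative
      (\<lambda>u. dird (0, dird (0, u) G (x, 0)) (dird (0, dird (0, v) G (x, 0)) \<Phi>) (x, G (x, 0))
        + dird (0, dird (0, u) (dird (0, v) G) (x, 0)) \<Phi> (x, G (x, 0)))) (at 0)"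
    by (rule has_derivative_dird_along[OF \<Phi> open_UT _ has_derivative_Pair[OF has_derivative_const g]
          has_derivative_Pair[OF has_derivative_const slice_derivative[OF smooth_on_dird[OF G_smooth] x]]])
       (simp add: x)
  from dird_eq[OF this, of u]
  show "dird u (\<lambda>t. dird (0, dird (0, v) G (x, t)) \<Phi> (x, G (x, t))) 0
      = dird (0, B x u) (dird (0, B x v) \<Phi>) (x, 0) + dird (0, dird (0, u) (dird (0, v) G) (x, 0)) \<Phi> (x, 0)"
    by (simp add: G_0[OF x] B_def)
qed

text \<open>Two derivatives in \<open>t\<close> of the identity \<open>F (x, G (x, t)) = t\<close>
  give a vanishing sum of \<open>C\<close> and \<open>A\<close> of the unknown, which is solved with
  \<open>B\<close>.\<close>

lemma G_second_derivative:
  assumes x: "x \<in> U"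
  shows "dird (0, u) (dird (0, v) G) (x, 0) = - christoffel x (B x u) (B x v)"
proof -
  let ?g = "dird (0, u) (dird (0, v) G) (x, 0)"
  have "dird (0, dird (0, v) G (x, t)) F (x, G (x, t)) = v" for t
    using dird_along_G(1)[OF x F_smooth, of v t] dird_eq[OF has_derivative_ident, of v t] by (simp add: FG[OF x])
  then have "dird u (\<lambda>t. v) 0 = C x (B x u) (B x v) + A x ?g"
    using dird_along_G(2)[OF x F_smooth, of u v] by (simp add: C_def A_def)
  then have "A x ?g = - C x (B x u) (B x v)"
    using dird_eq[OF has_derivative_const, of u v "0 :: real ^ 'n"] by (simp add: eq_neg_iff_add_eq_0 add.commute)
  then have "B x (A x ?g) = - christoffel x (B x u) (B x v)"
    by (simp add: christoffel_def linear_neg[OF linear_B[OF x]])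
  then show ?thesis by (simp add: BA[OF x])
qed

text \<open>Differentiating \<open>H(y, K(y,t)) = t\<close> in \<open>y\<close> eliminates the \<open>x\<close>-derivative of \<open>K\<close> from \<open>\<mu>\<close>.\<close>

lemma mu_mat_mult:
  assumes x: "x \<in> U"
  shows "mu_mat \<phi> x t *v v = dird (- B x v, B x v) F (x, G (x, t))"
proof -
  let ?z = "(x, G (x, t))"
  have z: "?z \<in> U \<times> UNIV" and xt: "(x, t) \<in> U \<times> UNIV" using x by auto
  note lin = linear_dird[OF diffF[OF z]]
  have g: "((\<lambda>t'. G (x, t')) has_derivative B x) (at 0)"
    using slice_derivative[OF G_smooth x] by (simp add: B_def[abs_def])
  have "((\<lambda>t'. (x + G (x, t'), t)) has_derivative (\<lambda>v. (B x v, 0))) (at 0)"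
    using has_derivative_Pair[OF has_derivative_add[OF has_derivative_const g] has_derivative_const] by simp
  from has_derivative_compose[OF this has_derivative_dird[OF diffG]]
  have "((\<lambda>t'. G (x + G (x, t'), t)) has_derivative (\<lambda>v. dird (B x v, 0) G (x, t))) (at 0)"
    using x by (simp add: G_0)
  from slice_has_derivative[OF F_smooth x has_derivative_add[OF g this]]
  have 1: "mu_mat \<phi> x t *v v = dird (0, B x v + dird (B x v, 0) G (x, t)) F ?z"
    unfolding mu_mat_def mult_fun_eq using jacobian_mult_vec by (fastforce simp: G_0[OF x])
  have "((\<lambda>y. (y, G (y, t))) has_derivative (\<lambda>u. (u, dird (u, 0) G (x, t)))) (at x)"
    using has_derivative_Pair[OF has_derivative_ident has_derivative_compose[OF
        has_derivative_Pair[OF has_derivative_ident has_derivative_const] has_derivative_dird[OF diffG[OF xt]]]] .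
  from has_derivative_compose[OF this has_derivative_dird[OF diffF[OF z]]]
  have 3: "((\<lambda>y. F (y, G (y, t))) has_derivative (\<lambda>u. dird (u, dird (u, 0) G (x, t)) F ?z)) (at x)" .
  have 4: "((\<lambda>y. F (y, G (y, t))) has_derivative (\<lambda>u. 0)) (at x)"
    by (rule has_derivative_transform_within_open[OF has_derivative_const open_U x]) (simp add: FG)
  have 2: "dird (u, dird (u, 0) G (x, t)) F ?z = 0" for u
    using fun_cong[OF has_derivative_unique[OF 3 4]] .
  have "(0, B x v + dird (B x v, 0) G (x, t)) = (- B x v, B x v) + (B x v, dird (B x v, 0) G (x, t))"
    by simp
  then show ?thesis unfolding 1 by (simp only: linear_add[OF lin] 2 add_0_right)
qed

text \<open>The entries of \<mu> are a fixed-direction derivative of \<open>F\<close> along the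
  curve of parameters, so the rule for two derivatives along it applies; the minus sign comes from
  the second derivative of \<open>K\<close>.\<close>

lemma rho_coeff_eq:
  assumes x: "x \<in> U"
  shows "rho_coeff \<phi> x m l k n =
    (dird (0, B x (axis l 1)) (dird (0, B x (axis k 1)) (dird (- B x (axis n 1), B x (axis n 1)) F)) (x, 0)
     - dird (0, christoffel x (B x (axis l 1)) (B x (axis k 1))) (dird (- B x (axis n 1), B x (axis n 1)) F) (x, 0)) $ m"
proof -
  let ?F = "dird (- B x (axis n 1), B x (axis n 1)) F"
  let ?q = "\<lambda>t. dird (0, dird (0, axis k 1) G (x, t)) ?F (x, G (x, t))"
  note F1 = smooth_on_dird[OF F_smooth, of "(- B x (axis n 1), B x (axis n 1))"]
  have "mu_mat \<phi> x t $ m $ n = ?F (x, G (x, t)) $ m" for t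
    using mu_mat_mult[OF x] by (simp add: matrix_entry_mult_axis)
  then have "partial_at k (\<lambda>t. mu_mat \<phi> x t $ m $ n) t = ?q t $ m" for t
    using dird_nth[OF differentiableI[OF slice_has_derivative[OF F1 x slice_derivative[OF G_smooth x]]]]
    by (simp add: partial_at_def frechet_derivative_dird dird_along_G(1)[OF x F1])
  then have "partial_at k (\<lambda>t. mu_mat \<phi> x t $ m $ n) = (\<lambda>t. ?q t $ m)" by (rule ext)
  then have "rho_coeff \<phi> x m l k n = dird (axis l 1) (\<lambda>t. ?q t $ m) 0"
    by (simp only: rho_coeff_def partial_at_def[of l] frechet_derivative_dird)
  also have "\<dots> = dird (axis l 1) ?q 0 $ m"
    by (rule dird_nth[OF differentiableI[OF has_derivative_dird_along[OF F1 open_UT _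
        has_derivative_Pair[OF has_derivative_const slice_derivative[OF G_smooth x]]
          has_derivative_Pair[OF has_derivative_const slice_derivative[OF smooth_on_dird[OF G_smooth] x]]]]])
       (use x in simp)
  finally show ?thesis
    using x linear_neg[OF linear_dird[OF smooth_on_differentiable[OF F1]], of "(x, 0)"
        "(0, christoffel x (B x (axis l 1)) (B x (axis k 1)))"]
    by (simp add: dird_along_G(2)[OF x F1] G_second_derivative[OF x])
qed

text \<open>The identity \<open>A x (christoffel x u v) = C x u v\<close> is differentiated in the
  point: on the left both \<open>A\<close> and the Christoffel field vary.\<close>

lemma C_base_derivative:
  assumes x: "x \<in> U"
  shows "dird (w, 0) (dird (0, u) (dird (0, v) F)) (x, 0)
    = dird (w, 0) (dird (0, christoffel x u v) F) (x, 0) + A x (dird w (\<lambda>y. christoffel y u v) x)"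
proof -
  have x0: "(x, 0) \<in> U \<times> (UNIV :: (real ^ 'n) set)" using x by simp
  note c = smooth_christoffel[OF smooth_on_const[OF open_U] smooth_on_const[OF open_U], of u v]
  have "((\<lambda>y. (y, 0 :: real ^ 'n)) has_derivative (\<lambda>w. (w, 0))) (at x)"
    by (rule has_derivative_Pair[OF has_derivative_ident has_derivative_const])
  note p = this
  have "((\<lambda>y. dird (0, christoffel y u v) F (y, 0)) has_derivative
    (\<lambda>w. dird (w, 0) (dird (0, christoffel x u v) F) (x, 0)
      + dird (0, dird w (\<lambda>y. christoffel y u v) x) F (x, 0))) (at x)"
    by (rule has_derivative_dird_along[OF F_smooth open_UT x0 p
          has_derivative_Pair[OF has_derivative_const smooth_on_has_derivative[OF c x]]])
  then have 1: "((\<lambda>y. dird (0, u) (dird (0, v) F) (y, 0)) has_derivative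
    (\<lambda>w. dird (w, 0) (dird (0, christoffel x u v) F) (x, 0)
      + A x (dird w (\<lambda>y. christoffel y u v) x))) (at x)"
    unfolding A_def
    by (rule has_derivative_transform_within_open[OF _ open_U x])
       (use A_christoffel in \<open>simp add: A_def C_def\<close>)
  have 2: "((\<lambda>y. dird (0, u) (dird (0, v) F) (y, 0)) has_derivative
      (\<lambda>w. dird (w, 0) (dird (0, u) (dird (0, v) F)) (x, 0))) (at x)"
    using has_derivative_compose[OF p smooth_on_has_derivative[OF smooth_on_dird[OF smooth_on_dird[OF F_smooth]] x0]] .
  show ?thesis using fun_cong[OF has_derivative_unique[OF 2 1]] .
qed

text \<open>The direction \<open>(- n, n)\<close> splits into a parameter part and a point part. The
  point part of the third derivative is rewritten by differentiating \<open>C\<close>, and the mixed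
  second derivative this creates cancels against the one in the subtracted term.\<close>

lemma rho_third_order:
  assumes x: "x \<in> U"
  shows "dird (0, a) (dird (0, b) (dird (- n, n) F)) (x, 0) - dird (0, christoffel x a b) (dird (- n, n) F) (x, 0)
    = dird (0, a) (dird (0, n) (dird (0, b) F)) (x, 0)
      - A x (dird n (\<lambda>y. christoffel y a b) x) - A x (christoffel x n (christoffel x a b))"
proof -
  have x0: "(x, 0) \<in> U \<times> (UNIV :: (real ^ 'n) set)" using x by simp
  note sF = smooth_on_dird[OF F_smooth] and ssF = smooth_on_dird[OF smooth_on_dird[OF F_smooth]]
  have split: "(- n, n) = (0, n) - (n, 0)" by simp
  have "dird (0, a) (dird (0, b) (dird (- n, n) F)) (x, 0) = dird (0, a) (dird (- n, n) (dird (0, b) F)) (x, 0)"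
    by (rule dird_cong[OF open_UT x0 _ smooth_on_differentiable[OF ssF x0]])
       (rule dird_commute[OF F_smooth open_UT])
  also have "\<dots> = dird (0, a) (dird (0, n) (dird (0, b) F)) (x, 0) - dird (0, a) (dird (n, 0) (dird (0, b) F)) (x, 0)"
    unfolding split by (rule bilinear_rsub[OF bilinear_dird_dird[OF sF open_UT x0]])
  also have "dird (0, a) (dird (n, 0) (dird (0, b) F)) (x, 0) = dird (n, 0) (dird (0, a) (dird (0, b) F)) (x, 0)"
    by (rule dird_commute[OF sF open_UT x0])
  finally have 1: "dird (0, a) (dird (0, b) (dird (- n, n) F)) (x, 0)
    = dird (0, a) (dird (0, n) (dird (0, b) F)) (x, 0)
      - (dird (n, 0) (dird (0, christoffel x a b) F) (x, 0) + A x (dird n (\<lambda>y. christoffel y a b) x))"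
    unfolding C_base_derivative[OF x] .
  have "dird (0, christoffel x a b) (dird (- n, n) F) (x, 0)
    = C x (christoffel x a b) n - dird (0, christoffel x a b) (dird (n, 0) F) (x, 0)"
    unfolding split C_def by (rule bilinear_rsub[OF bilinear_dird_dird[OF F_smooth open_UT x0]])
  moreover have "dird (0, christoffel x a b) (dird (n, 0) F) (x, 0) = dird (n, 0) (dird (0, christoffel x a b) F) (x, 0)"
    by (rule dird_commute[OF F_smooth open_UT x0])
  moreover have "C x (christoffel x a b) n = A x (christoffel x n (christoffel x a b))"
    by (metis A_christoffel[OF x] christoffel_sym[OF x])
  ultimately show ?thesis unfolding 1 by (simp add: algebra_simps)
qed

text \<open>Antisymmetrizing in \<open>k\<close> and \<open>n\<close> removes the pure third
  parameter derivative; what remains is \<open>A x\<close> of the coordinate formula for the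
  curvature.\<close>

lemma curvature_vielbein:
  assumes x: "x \<in> U"
  shows "curvature conn (vielbein H k) (vielbein H n) (vielbein H l) x
    = (\<Sum>m\<in>UNIV. left_curvature \<phi> x m l k n *\<^sub>R vielbein H m x)"
proof -
  have x0: "(x, 0) \<in> U \<times> (UNIV :: (real ^ 'n) set)" using x by simp
  let ?X = "\<lambda>i. B x (axis i 1)"
  note lin = linear_A[OF x]
  have diff: "(\<lambda>y. christoffel y u v) differentiable (at x)" for u v
    by (rule smooth_on_differentiable[OF smooth_christoffel[OF smooth_on_const[OF open_U] smooth_on_const[OF open_U]] x])
  have sym: "dird w (\<lambda>y. christoffel y u v) x = dird w (\<lambda>y. christoffel y v u) x" for w u v
    by (rule dird_cong[OF open_U x christoffel_sym diff])
  \<comment> \<open>The index \<open>l\<close> is outermost in both orderings, so only the two inner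
    directions are exchanged.\<close>
  have third: "dird (0, a) (dird (0, b) (dird (0, c) F)) (x, 0) = dird (0, a) (dird (0, c) (dird (0, b) F)) (x, 0)" for a b c
    by (rule dird_cong[OF open_UT x0 dird_commute[OF F_smooth open_UT]
          smooth_on_differentiable[OF smooth_on_dird[OF smooth_on_dird[OF F_smooth]] x0]])
  have "left_curvature \<phi> x m l k n =
      (A x (dird (?X k) (\<lambda>y. christoffel y (?X l) (?X n)) x) + A x (christoffel x (?X k) (christoffel x (?X l) (?X n)))
       - A x (dird (?X n) (\<lambda>y. christoffel y (?X l) (?X k)) x) - A x (christoffel x (?X n) (christoffel x (?X l) (?X k)))) $ m" for m
    unfolding left_curvature_def rho_coeff_eq[OF x] rho_third_order[OF x] third[of "?X l" "?X n" "?X k"]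
    by simp
  moreover have "curvature conn (vielbein H k) (vielbein H n) (vielbein H l) x
    = dird (?X k) (\<lambda>y. christoffel y (?X l) (?X n)) x - dird (?X n) (\<lambda>y. christoffel y (?X l) (?X k)) x
      + christoffel x (?X k) (christoffel x (?X l) (?X n)) - christoffel x (?X n) (christoffel x (?X l) (?X k))"
    \<comment> \<open>The frame fields are restored so that the coordinate formula applies, and
      \<Gamma> is turned so that the transported vector stands in its second slot.\<close>
    unfolding vielbein_eq[OF x, symmetric]
    unfolding sym[of _ "vielbein H l x"] christoffel_sym[OF x, of "vielbein H l x"]
    by (rule curvature_conn_of[OF open_U x bilinear_christoffel diff christoffel_sym[OF x]
        smooth_vielbein smooth_vielbein smooth_vielbein])
  ultimately have "left_curvature \<phi> x m l k n = A x (curvature conn (vielbein H k) (vielbein H n) (vielbein H l) x) $ m" for m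
    by (simp add: linear_diff[OF lin] linear_add[OF lin])
  then show ?thesis by (simp add: vielbein_sum[OF x])
qed

end

text \<open>The first-order conditions on the action and on transport have this shape, with
  \<open>P\<close> the requirement to stay in the chart. As \<open>P\<close> holds near 0, shrinking
  \<open>d\<close> absorbs it.\<close>

lemma has_derivative_at_0_iff:
  fixes f :: "'a::euclidean_space \<Rightarrow> 'b::real_normed_vector"
  assumes "linear L" "\<forall>\<^sub>F t in nhds 0. P t"
  shows "(\<forall>e>0. \<exists>d>0. \<forall>t. norm t < d \<longrightarrow> P t \<longrightarrow> norm (f t - f 0 - L t) \<le> e * norm t) \<longleftrightarrow>
    (f has_derivative L) (at 0)"
    (is "?l \<longleftrightarrow> ?r")
proof -
  obtain d0 where d0: "d0 > 0" "\<And>t. norm t < d0 \<Longrightarrow> P t"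
    using assms(2) by (auto simp: eventually_nhds_metric)
  have "(\<exists>d>0. \<forall>t. norm t < d \<longrightarrow> P t \<longrightarrow> Q t) \<longleftrightarrow> (\<exists>d>0. \<forall>t. norm t < d \<longrightarrow> Q t)" for Q
  proof
    assume "\<exists>d>0. \<forall>t. norm t < d \<longrightarrow> P t \<longrightarrow> Q t"
    then obtain d where "d > 0" "\<forall>t. norm t < d \<longrightarrow> P t \<longrightarrow> Q t" by blast
    then show "\<exists>d>0. \<forall>t. norm t < d \<longrightarrow> Q t" using d0 by (intro exI[of _ "min d d0"]) auto
  qed blast
  then show ?thesis
    using linear_conv_bounded_linear[THEN iffD1, OF assms(1)] by (simp add: has_derivative_at_alt)
qed

lemma has_derivative_at_iff: "(f has_derivative f') (at x) \<Longrightarrow> (f has_derivative g') (at x) \<longleftrightarrow> g' = f'"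
  using has_derivative_unique by blast

section \<open>First-order conditions over group elements, and the connection they specify\<close>

context deformed
begin

text \<open>Constant maps have zero Jacobian and so lie in the undeformed group; since
  \<open>H x\<close> is onto, their deformations take every value at \<open>x\<close>. Conditions on
  \<open>t x\<close> thus range over all parameters.\<close>

lemma deformed_group_values:
  assumes "x \<in> U"
  shows "(\<lambda>t. t x) ` deformed_group U H = UNIV"
proof -
  have const: "(\<lambda>_. s) \<in> undeformed_group U" for s :: "real ^ 'n"
  proof -
    have "jacobian (\<lambda>_. s) (at x) = 0" for x :: "real ^ 'n"
      using jacobian_mult_vec[OF has_derivative_const, of s x] by (simp add: matrix_eq)
    then show ?thesis by (simp add: undeformed_group_def smooth_on_const[OF open_U])
  qed
  have "t \<in> (\<lambda>t. t x) ` deformed_group U H" for t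
  proof -
    obtain s where "F (x, s) = t" using F_surj[OF assms] by blast
    then have "deform H (\<lambda>_. s) x = t" by (simp add: F_def deform_def)
    then show ?thesis using const[of s] by (force simp: deformed_group_def)
  qed
  then show ?thesis by auto
qed

lemma ball_deformed_group:
  assumes "x \<in> U"
  shows "(\<forall>t\<in>deformed_group U H. Q (t x)) \<longleftrightarrow> (\<forall>t. Q t)"
  using deformed_group_values[OF assms] by (metis (no_types, lifting) UNIV_I imageE imageI)

lemma linear_comps: "linear (\<lambda>t :: real ^ 'n. \<Sum>m\<in>UNIV. t $ m *\<^sub>R E m)"
  for E :: "'n \<Rightarrow> real ^ 'n"
  by (intro linearI) (simp_all add: scaleR_add_left sum.distrib scaleR_sum_right)

lemma linear_comps_eq_iff:
  fixes L :: "real ^ 'n \<Rightarrow> real ^ 'n"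
  assumes "linear L"
  shows "(\<lambda>t. \<Sum>m\<in>UNIV. t $ m *\<^sub>R E m) = L \<longleftrightarrow> (\<forall>m. E m = L (axis m 1))"
proof
  assume "(\<lambda>t. \<Sum>m\<in>UNIV. t $ m *\<^sub>R E m) = L"
  then have "L (axis m 1) = (\<Sum>i\<in>UNIV. axis m 1 $ i *\<^sub>R E i)" for m by auto
  then show "\<forall>m. E m = L (axis m 1)"
    by (simp add: axis_def if_distrib[of "\<lambda>r. r *\<^sub>R _"] cong: if_cong)
next
  assume "\<forall>m. E m = L (axis m 1)"
  then show "(\<lambda>t. \<Sum>m\<in>UNIV. t $ m *\<^sub>R E m) = L"
    by (intro ext) (simp add: linear_vec_expansion[OF assms, symmetric])
qed

text \<open>At each point the condition says that the combination of the \<open>E m x\<close> is the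
  derivative of the action at 0; that derivative is \<open>B x\<close>, and derivatives are
  unique.\<close>

lemma infinitesimal_action_iff:
  "infinitesimal_action U H K E \<longleftrightarrow> (\<forall>m. \<forall>x\<in>U. E m x = vielbein H m x)"
proof -
  have "(\<forall>e>0. \<exists>d>0. \<forall>t\<in>deformed_group U H. norm (t x) < d \<longrightarrow>
        norm (act_fun K x (t x) - x - (\<Sum>m\<in>UNIV. t x $ m *\<^sub>R E m x)) \<le> e * norm (t x))
      \<longleftrightarrow> (\<forall>m. E m x = vielbein H m x)" if x: "x \<in> U" for x
  proof -
    let ?L = "\<lambda>t. \<Sum>m\<in>UNIV. t $ m *\<^sub>R E m x"
    have B: "(act_fun K x has_derivative B x) (at 0)"
      using has_derivative_add[OF has_derivative_const slice_derivative[OF G_smooth x, of 0], of x]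
      by (simp add: B_def[abs_def] act_fun_G[abs_def])
    have "(\<forall>e>0. \<exists>d>0. \<forall>t\<in>deformed_group U H. norm (t x) < d \<longrightarrow>
          norm (act_fun K x (t x) - x - ?L (t x)) \<le> e * norm (t x))
        \<longleftrightarrow> (act_fun K x has_derivative ?L) (at 0)"
      using has_derivative_at_0_iff[OF linear_comps, of "\<lambda>_. True" "act_fun K x" "\<lambda>m. E m x"]
        ball_deformed_group[OF x, of "\<lambda>t. norm t < _ \<longrightarrow> norm (act_fun K x t - x - ?L t) \<le> _ * norm t"]
      by (simp add: act_fun_G G_0[OF x])
    also have "\<dots> \<longleftrightarrow> ?L = B x"
      by (rule has_derivative_at_iff[OF B])
    also have "\<dots> \<longleftrightarrow> (\<forall>m. E m x = vielbein H m x)"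
      by (simp add: linear_comps_eq_iff[OF linear_B[OF x]] vielbein_eq[OF x])
    finally show ?thesis .
  qed
  then show ?thesis unfolding infinitesimal_action_def by auto
qed

lemma infinitesimal_transport_iff:
  assumes \<tau>: "smooth_on U \<tau>"
  shows "infinitesimal_transport U H K \<tau> N \<longleftrightarrow> (\<forall>n. \<forall>x\<in>U. N n x = cov_deriv H \<phi> \<tau> n x)"
proof -
  have "(\<forall>e>0. \<exists>d>0. \<forall>t\<in>deformed_group U H. norm (t x) < d \<longrightarrow> act_fun K x (t x) \<in> U \<longrightarrow>
        norm (parallel_transport H K t \<tau> x - \<tau> x - (\<Sum>n\<in>UNIV. t x $ n *\<^sub>R N n x)) \<le> e * norm (t x))
      \<longleftrightarrow> (\<forall>n. N n x = cov_deriv H \<phi> \<tau> n x)" if x: "x \<in> U" for x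
  proof -
    let ?L = "\<lambda>t. \<Sum>m\<in>UNIV. t $ m *\<^sub>R N m x"
    let ?P = "\<lambda>t. lambda_mat \<phi> x t *v \<tau> (x + G (x, t))"
    let ?D = "\<lambda>u. A x (conn (\<lambda>_. B x u) (field_of_comps H \<tau>) x)"
    note P = lambda_transport[OF x \<tau>]
    \<comment> \<open>Transport along the zero parameter is the identity, so the expansion indeed
      starts with \<tau>.\<close>
    have "lambda_mat \<phi> x 0 *v v = v" for v
      using lambda_mat_mult[OF x, of 0 v] by (simp add: G_0[OF x] x A_def[symmetric] AB[OF x])
    then have P0: "?P 0 = \<tau> x" by (simp add: G_0[OF x])
    have ev: "\<forall>\<^sub>F t in nhds 0. x + G (x, t) \<in> U"
      using open_small[OF x] x unfolding eventually_nhds by (intro exI[of _ "{t. x + G (x, t) \<in> U}"]) (simp add: G_0)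
    have "(\<forall>e>0. \<exists>d>0. \<forall>t\<in>deformed_group U H. norm (t x) < d \<longrightarrow> act_fun K x (t x) \<in> U \<longrightarrow>
          norm (parallel_transport H K t \<tau> x - \<tau> x - ?L (t x)) \<le> e * norm (t x))
        \<longleftrightarrow> (\<forall>e>0. \<exists>d>0. \<forall>t. norm t < d \<longrightarrow> x + G (x, t) \<in> U \<longrightarrow>
          norm (?P t - ?P 0 - ?L t) \<le> e * norm t)"
      using ball_deformed_group[OF x, of "\<lambda>t. norm t < _ \<longrightarrow> x + G (x, t) \<in> U \<longrightarrow> norm (?P t - \<tau> x - ?L t) \<le> _ * norm t"]
      by (simp only: P0 act_fun_G parallel_transport_def)
    also have "\<dots> \<longleftrightarrow> (?P has_derivative ?L) (at 0)"
      by (rule has_derivative_at_0_iff[OF linear_comps ev])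
    also have "\<dots> \<longleftrightarrow> ?L = ?D"
      by (rule has_derivative_at_iff[OF P])
    also have "\<dots> \<longleftrightarrow> (\<forall>n. N n x = ?D (axis n 1))"
      by (rule linear_comps_eq_iff[OF has_derivative_linear[OF P]])
    finally show ?thesis
      by (simp add: cov_deriv_eq[OF x \<tau>] conn_of_def vielbein_eq[OF x])
  qed
  then show ?thesis unfolding infinitesimal_transport_def by auto
qed

text \<open>At each point the frame is the image of the standard basis under the bijective linear
  map \<open>B x\<close>.\<close>

lemma frame_field_vielbein: "frame_field U (vielbein H)"
  unfolding frame_field_def
proof (intro conjI allI ballI)
  fix x assume x: "x \<in> U"
  have inj: "inj (B x)" using AB[OF x] by (intro injI) metis
  have img: "range (\<lambda>m. vielbein H m x) = B x ` range (\<lambda>m. axis m 1)"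
    by (simp add: vielbein_eq[OF x] image_image)
  have basis: "range (\<lambda>m. axis m 1) = (Basis :: (real ^ 'n) set)" by (auto simp: Basis_vec_def)
  show "inj (\<lambda>m. vielbein H m x)"
    by (rule injI) (use injD[OF inj] in \<open>force simp: vielbein_eq[OF x] axis_eq_axis\<close>)
  show "independent (range (\<lambda>m. vielbein H m x))"
    unfolding img basis using inj
    by (intro linear_independent_injective_image[OF linear_B[OF x]] independent_Basis) (auto simp: inj_on_def)
  have "surj (B x)" using BA[OF x] by (metis surjI)
  then show "span (range (\<lambda>m. vielbein H m x)) = UNIV"
    unfolding img basis linear_span_image[OF linear_B[OF x]] by simp
qed (rule smooth_vielbein)

text \<open>\<open>K\<close> undoes \<open>H\<close> at the point and at the moved point, which is
  where the condition on \<open>x + s x\<close> enters.\<close>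

lemma deformed_mult_deform:
  assumes "x \<in> U" "x + s x \<in> U"
  shows "deformed_mult H K (deform H s) (deform H s') x = deform H (undeformed_mult s s') x"
proof -
  have "K y (H y u) = u" if "y \<in> U" for y u using GF[OF that] by (simp add: F_def G_def)
  then show ?thesis
    using assms by (simp add: deformed_mult_def mult_fun_def deform_def act_fun_def undeformed_mult_def)
qed

text \<open>The transport condition becomes an equation of Christoffel symbols. Constant components
  give it on pairs of frame vectors, which span; conversely these values determine the
  connection.\<close>

lemma specifies_connection_iff:
  assumes D: "affine_connection U D"
  shows "specifies_connection U H K D \<longleftrightarrow>
    (\<forall>x\<in>U. \<forall>u v. D (\<lambda>_. u) (\<lambda>_. v) x = christoffel x u v)"
proof -
  have "specifies_connection U H K D \<longleftrightarrow> (\<forall>\<tau>. smooth_on U \<tau> \<longrightarrow> (\<forall>n. \<forall>x\<in>U.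
      D (vielbein H n) (field_of_comps H \<tau>) x = conn (vielbein H n) (field_of_comps H \<tau>) x))"
    (is "_ \<longleftrightarrow> (\<forall>\<tau>. _ \<longrightarrow> ?Q \<tau>)")
  proof -
    have "(\<exists>N. infinitesimal_transport U H K \<tau> N \<and>
        (\<forall>n. \<forall>x\<in>U. D (vielbein H n) (field_of_comps H \<tau>) x = field_of_comps H (N n) x)) \<longleftrightarrow> ?Q \<tau>"
      (is "(\<exists>N. ?R N) \<longleftrightarrow> _") if \<tau>: "smooth_on U \<tau>" for \<tau>
    proof -
      \<comment> \<open>Transport forces the coefficients \<open>N\<close> on the chart, so the
        existential quantifier disappears.\<close>
      have "?R N \<longleftrightarrow> (\<forall>n. \<forall>x\<in>U. N n x = cov_deriv H \<phi> \<tau> n x) \<and> ?Q \<tau>" for N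
        unfolding infinitesimal_transport_iff[OF \<tau>]
        using field_of_comps_eq cov_deriv_eq[OF _ \<tau>] BA by (auto simp: Ball_def)
      then show ?thesis by auto
    qed
    then show ?thesis unfolding specifies_connection_def using D by blast
  qed
  also have "\<dots> \<longleftrightarrow> (\<forall>x\<in>U. \<forall>u v. D (\<lambda>_. u) (\<lambda>_. v) x = christoffel x u v)"
  proof (intro iffI ballI allI impI)
    fix x u v
    assume *: "\<forall>\<tau>. smooth_on U \<tau> \<longrightarrow> ?Q \<tau>" and x: "x \<in> U"
    have "D (vielbein H n) (vielbein H k) x = conn (vielbein H n) (vielbein H k) x" for n k
      using *[rule_format, OF smooth_on_const[OF open_U] x, of n "axis k 1"] by (simp add: field_of_comps_axis)
    then have eq: "D (\<lambda>_. vielbein H n x) (\<lambda>_. vielbein H k x) x = christoffel x (vielbein H n x) (vielbein H k x)" for n k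
      using conn_eq_conn_of[OF open_U D smooth_vielbein smooth_vielbein x] by (simp add: conn_of_def)
    let ?V = "range (\<lambda>m. vielbein H m x)"
    have span: "UNIV \<subseteq> span ?V" using frame_field_vielbein x by (simp add: frame_field_def)
    show "D (\<lambda>_. u) (\<lambda>_. v) x = christoffel x u v"
      by (rule bilinear_eq[OF bilinear_conn_const[OF open_U D x] bilinear_christoffel[OF x] span span UNIV_I UNIV_I])
         (use eq in auto)
  next
    fix \<tau> :: "real ^ 'n \<Rightarrow> real ^ 'n" and n x
    assume *: "\<forall>x\<in>U. \<forall>u v. D (\<lambda>_. u) (\<lambda>_. v) x = christoffel x u v"
      and \<tau>: "smooth_on U \<tau>" and x: "x \<in> U"
    show "D (vielbein H n) (field_of_comps H \<tau>) x = conn (vielbein H n) (field_of_comps H \<tau>) x"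
      using conn_eq_conn_of[OF open_U D smooth_vielbein smooth_field_of_comps[OF \<tau>] x] * x
      by (simp add: conn_of_def)
  qed
  finally show ?thesis .
qed

lemma specifies_conn: "specifies_connection U H K conn"
proof -
  have "conn (\<lambda>_. u) (\<lambda>_. v) x = christoffel x u v" for x u v
    by (simp add: conn_of_def dird_eq[OF has_derivative_const])
  then show ?thesis using specifies_connection_iff[OF affine_conn] by simp
qed

text \<open>Both connections have the same values on constant fields, hence agree on all smooth
  ones.\<close>

lemma specifies_connection_unique:
  assumes "specifies_connection U H K D" "smooth_on U Y" "smooth_on U Z" "x \<in> U"
  shows "D Y Z x = conn Y Z x"
proof -
  have D: "affine_connection U D" using assms(1) by (simp add: specifies_connection_def)
  show ?thesis
    using conn_eq_conn_of[OF open_U D assms(2-4)] specifies_connection_iff[OF D] assms(1,4)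
    by (simp add: conn_of_def)
qed

end

subsection \<open>Deformations with prescribed second order\<close>

lemma smooth_on_sqrt_compose:
  assumes "open S" "smooth_on S f" "\<And>x. x \<in> S \<Longrightarrow> f x > 0"
  shows "smooth_on S (\<lambda>x. sqrt (f x))"
  by (rule smooth_on_compose[OF smooth_on_sqrt assms(2,1)]) (use assms(3) in auto)

lemma smooth_on_inverse_compose:
  fixes f :: "'a::real_normed_vector \<Rightarrow> real"
  assumes "open S" "smooth_on S f" "\<And>x. x \<in> S \<Longrightarrow> f x > 0"
  shows "smooth_on S (\<lambda>x. inverse (f x))"
  by (rule smooth_on_compose[OF smooth_on_inverse assms(2,1)]) (use assms(3) in auto)

lemma smooth_on_power2:
  fixes f :: "'a::real_normed_vector \<Rightarrow> real"
  shows "open S \<Longrightarrow> smooth_on S f \<Longrightarrow> smooth_on S (\<lambda>x. (f x)\<^sup>2)"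
  unfolding power2_eq_square by (rule smooth_on_mult)

text \<open>\<open>\<theta> q r = r\<^sup>2/2 + O(r\<^sup>4)\<close> has slope of modulus less than \<open>1/sqrt q\<close>, and \<open>r + a \<theta> q r\<close> with
  \<open>q = 1 + a\<^sup>2\<close> is a diffeomorphism of the line whose inverse is explicit, being given by a quadratic
  equation.\<close>

definition theta :: "real \<Rightarrow> real \<Rightarrow> real" where
  "theta q r = (sqrt (1 + q * r\<^sup>2) - 1) * inverse q"

definition theta_inverse :: "real \<Rightarrow> real \<Rightarrow> real" where
  "theta_inverse a y = (let q = 1 + a\<^sup>2; w = q * y + a in w - a * sqrt ((w\<^sup>2 + 1) * inverse q))"

lemma theta_inverse: "theta_inverse a (r + a * theta (1 + a\<^sup>2) r) = r"
proof -
  define q where "q = 1 + a\<^sup>2"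
  have q: "q > 0" by (simp add: q_def add_pos_nonneg)
  define R where "R = sqrt (1 + q * r\<^sup>2)"
  have R2: "R\<^sup>2 = 1 + q * r\<^sup>2" using q by (simp add: R_def)
  \<comment> \<open>This bound decides the sign of the square root taken below.\<close>
  have "(a * r)\<^sup>2 \<le> 1 + q * r\<^sup>2" by (simp add: q_def algebra_simps power_mult_distrib)
  then have "\<bar>a * r\<bar> \<le> R" unfolding R_def using real_le_rsqrt by auto
  then have pos: "R + a * r \<ge> 0" by linarith
  \<comment> \<open>The affine change of variable completes the square: \<open>w\<close> squared
    plus 1 is \<open>q\<close> times the square of \<open>R + a * r\<close>. Subtracting
    \<open>a\<close> times that root from \<open>w\<close> leaves \<open>r\<close>, because
    \<open>q\<close> minus the square of \<open>a\<close> is 1.\<close>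
  define w where "w = q * (r + a * theta q r) + a"
  have w: "w = q * r + a * R"
    using q by (simp add: w_def theta_def R_def algebra_simps)
  have "w\<^sup>2 + 1 = (q * r)\<^sup>2 + 2 * q * a * r * R + a\<^sup>2 * R\<^sup>2 + 1"
    by (simp add: w power2_eq_square algebra_simps)
  also have "\<dots> = (R + a * r)\<^sup>2 * q"
    unfolding power2_sum R2 by (simp add: q_def power2_eq_square algebra_simps)
  finally have "(w\<^sup>2 + 1) * inverse q = (R + a * r)\<^sup>2" using q by simp
  then have "sqrt ((w\<^sup>2 + 1) * inverse q) = R + a * r" using pos by simp
  then show ?thesis
    unfolding theta_inverse_def Let_def q_def[symmetric] w_def[symmetric]
    by (simp add: w) (simp add: q_def power2_eq_square algebra_simps)
qed

lemma smooth_theta: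
  assumes "open S" "smooth_on S q" "smooth_on S r" "\<And>x. x \<in> S \<Longrightarrow> q x > 0"
  shows "smooth_on S (\<lambda>x. theta (q x) (r x))"
  unfolding theta_def
  using assms(4)
  by (intro smooth_on_mult smooth_on_diff smooth_on_sqrt_compose smooth_on_add smooth_on_const
      smooth_on_inverse_compose smooth_on_power2 assms(1-3)) (auto simp: add_pos_nonneg less_imp_le)

lemma smooth_theta_inverse:
  assumes "open S" "smooth_on S a" "smooth_on S y"
  shows "smooth_on S (\<lambda>x. theta_inverse (a x) (y x))"
  unfolding theta_inverse_def Let_def
  by (intro smooth_on_mult smooth_on_diff smooth_on_sqrt_compose smooth_on_add smooth_on_const
      smooth_on_inverse_compose smooth_on_power2 assms) (auto simp: add_pos_nonneg add_nonneg_pos)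

lemma theta_derivative:
  assumes "q > 0"
  shows "(theta q has_real_derivative r * inverse (sqrt (1 + q * r\<^sup>2))) (at r)"
proof -
  have "1 + q * r\<^sup>2 > 0" using assms by (simp add: add_pos_nonneg)
  then show ?thesis
    unfolding theta_def[abs_def] using assms
    by (auto intro!: derivative_eq_intros simp: field_simps)
qed

text \<open>With the first parameter derivative at 0 equal to the identity, the Christoffel field of
  the deformation is its second derivative \<open>Q\<close> itself.\<close>

definition realizable ::
  "(real ^ 'n::finite) set \<Rightarrow> (real ^ 'n \<Rightarrow> real ^ 'n \<Rightarrow> real ^ 'n \<Rightarrow> real ^ 'n) \<Rightarrow> bool" where
  "realizable U Q \<longleftrightarrow> (\<exists>H K. deformation U H \<and> deformation_inverse U H K \<and>
     (\<forall>x\<in>U. \<forall>u v. dird (0, v) (\<lambda>(x, s). H x s) (x, 0) = v \<and>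
        dird (0, u) (dird (0, v) (\<lambda>(x, s). H x s)) (x, 0) = Q x u v))"

lemma realizable_cong:
  "realizable U Q \<Longrightarrow> (\<And>x u v. x \<in> U \<Longrightarrow> Q x u v = Q' x u v) \<Longrightarrow> realizable U Q'"
  unfolding realizable_def by (metis (no_types, lifting))

lemma realizable_0:
  fixes U :: "(real ^ 'n::finite) set"
  assumes U: "open U"
  shows "realizable U (\<lambda>x u v. 0)"
proof -
  have S: "open (U \<times> (UNIV :: (real ^ 'n) set))" using U by (simp add: open_Times)
  have eq: "(\<lambda>(x, s). s) = (snd :: (real ^ 'n) \<times> (real ^ 'n) \<Rightarrow> _)" by auto
  have snd: "dird v snd = (\<lambda>_. snd v)" for v :: "(real ^ 'n) \<times> (real ^ 'n)"
    by (rule ext) (rule dird_eq[OF bounded_linear_imp_has_derivative[OF bounded_linear_snd]])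
  have inv: "deformation_inverse U (\<lambda>x s. s) (\<lambda>x s. s)"
    unfolding deformation_inverse_def eq by (simp add: smooth_on_bounded_linear[OF S bounded_linear_snd])
  moreover have "deformation U (\<lambda>x s. s)"
    unfolding deformation_def eq using inv by (auto simp: smooth_on_bounded_linear[OF S bounded_linear_snd])
  ultimately show ?thesis
    unfolding realizable_def
    by (intro exI[of _ "\<lambda>x s. s"]) (simp add: eq snd dird_eq[OF has_derivative_const])
qed

text \<open>The deformations are composed in the parameter. Both first derivatives at 0 are the
  identity and both maps fix 0, so the chain rule simply adds the second derivatives.\<close>

lemma realizable_add:
  fixes U :: "(real ^ 'n::finite) set"
  assumes U: "open U" and Q1: "realizable U Q1" and Q2: "realizable U Q2"
  shows "realizable U (\<lambda>x u v. Q1 x u v + Q2 x u v)"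
proof -
  let ?S = "U \<times> (UNIV :: (real ^ 'n) set)"
  obtain H1 K1 where H1: "deformation U H1" "deformation_inverse U H1 K1"
    and d1: "\<And>x v. x \<in> U \<Longrightarrow> dird (0, v) (\<lambda>(x, s). H1 x s) (x, 0) = v"
      "\<And>x u v. x \<in> U \<Longrightarrow> dird (0, u) (dird (0, v) (\<lambda>(x, s). H1 x s)) (x, 0) = Q1 x u v"
    using Q1 unfolding realizable_def by blast
  obtain H2 K2 where H2: "deformation U H2" "deformation_inverse U H2 K2"
    and d2: "\<And>x v. x \<in> U \<Longrightarrow> dird (0, v) (\<lambda>(x, s). H2 x s) (x, 0) = v"
      "\<And>x u v. x \<in> U \<Longrightarrow> dird (0, u) (dird (0, v) (\<lambda>(x, s). H2 x s)) (x, 0) = Q2 x u v"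
    using Q2 unfolding realizable_def by blast
  have S: "open ?S" using U by (simp add: open_Times)
  have comp: "smooth_on ?S (\<lambda>(x, s). P x (P' x s))"
    if P: "smooth_on ?S (\<lambda>(x, s). P x s)" and P': "smooth_on ?S (\<lambda>(x, s). P' x s)"
    for P P' :: "real ^ 'n \<Rightarrow> real ^ 'n \<Rightarrow> real ^ 'n"
    using smooth_on_compose[OF P smooth_on_Pair[OF S smooth_on_bounded_linear[OF S bounded_linear_fst] P'] S S]
    by (simp add: split_def image_subset_iff mem_Times_iff)
  let ?F1 = "\<lambda>(x, s). H1 x s" and ?F2 = "\<lambda>(x, s). H2 x s" and ?F = "\<lambda>(x, s). H2 x (H1 x s)"
  have F1: "smooth_on ?S ?F1" and F2: "smooth_on ?S ?F2" using H1(1) H2(1) by (auto simp: deformation_def)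
  have F: "smooth_on ?S ?F" by (rule comp[OF F2 F1])
  have "deformation_inverse U (\<lambda>x s. H2 x (H1 x s)) (\<lambda>x t. K1 x (K2 x t))"
    using H1(2) H2(2) comp[of K1 K2] by (simp add: deformation_inverse_def)
  moreover from this have "deformation U (\<lambda>x s. H2 x (H1 x s))"
    using H1(1) H2(1) F by (auto simp: deformation_def)
  moreover have "dird (0, v) ?F (x, 0) = v \<and> dird (0, u) (dird (0, v) ?F) (x, 0) = Q1 x u v + Q2 x u v"
    if x: "x \<in> U" for x u v
  proof -
    have x0: "(x, 0) \<in> ?S" using x by simp
    have H10: "H1 x 0 = 0" using H1(1) x by (simp add: deformation_def)
    have g: "((\<lambda>z. (fst z, ?F1 z)) has_derivative (\<lambda>w. (fst w, dird w ?F1 z))) (at z)" if "z \<in> ?S" for z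
      by (intro has_derivative_Pair bounded_linear_imp_has_derivative[OF bounded_linear_fst]
          smooth_on_has_derivative[OF F1 that])
    \<comment> \<open>The chain rule is needed at all points of the domain, since its result is
      differentiated again.\<close>
    have 1: "dird (0, v) ?F z = dird (0, dird (0, v) ?F1 z) ?F2 (fst z, ?F1 z)" if z: "z \<in> ?S" for z v
      using dird_compose[OF g[OF z] smooth_on_differentiable[OF F2], of "(0, v)"] z
      by (auto simp: split_def mem_Times_iff)
    have "((\<lambda>z. dird (0, dird (0, v) ?F1 z) ?F2 (fst z, ?F1 z)) has_derivative
       (\<lambda>w. dird (fst w, dird w ?F1 (x, 0)) (dird (0, dird (0, v) ?F1 (x, 0)) ?F2) (fst (x, 0 :: real ^ 'n), ?F1 (x, 0))
         + dird (0, dird w (dird (0, v) ?F1) (x, 0)) ?F2 (fst (x, 0 :: real ^ 'n), ?F1 (x, 0)))) (at (x, 0))"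
      by (rule has_derivative_dird_along[OF F2 S _ g[OF x0]
            has_derivative_Pair[OF has_derivative_const smooth_on_has_derivative[OF smooth_on_dird[OF F1] x0]]])
         (simp add: x)
    from dird_eq[OF this, of "(0, u)"]
    have "dird (0, u) (\<lambda>z. dird (0, dird (0, v) ?F1 z) ?F2 (fst z, ?F1 z)) (x, 0) = Q2 x u v + Q1 x u v"
      by (simp add: H10 d1[OF x] d2[OF x])
    moreover have "dird (0, u) (dird (0, v) ?F) (x, 0)
        = dird (0, u) (\<lambda>z. dird (0, dird (0, v) ?F1 z) ?F2 (fst z, ?F1 z)) (x, 0)"
      by (rule dird_cong[OF S x0 1 smooth_on_differentiable[OF smooth_on_dird[OF F] x0]])
    ultimately show ?thesis
      using 1[OF x0, of v] by (simp add: H10 d1[OF x] d2[OF x])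
  qed
  ultimately show ?thesis unfolding realizable_def by blast
qed

lemma realizable_sum:
  assumes "open U" "finite I" "\<And>i. i \<in> I \<Longrightarrow> realizable U (Q i)"
  shows "realizable U (\<lambda>x u v. \<Sum>i\<in>I. Q i x u v)"
  using assms(2,3)
  by (induction I rule: finite_induct) (simp_all add: realizable_0 realizable_add assms(1))

text \<open>The shift is along \<open>p x\<close> and depends on \<open>s\<close> only through
  \<open>r = l \<bullet> s\<close>, so inverting it is a one-dimensional problem: \<open>r\<close>
  is recovered from the \<open>l\<close> component of the image, after which the shift can be
  subtracted.\<close>

lemma realizable_rank_one:
  fixes U :: "(real ^ 'n::finite) set"
  assumes U: "open U" and p: "smooth_on U p"
  shows "realizable U (\<lambda>x u v. ((l \<bullet> u) * (l \<bullet> v)) *\<^sub>R p x)"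
proof -
  let ?S = "U \<times> (UNIV :: (real ^ 'n) set)"
  have S: "open ?S" using U by (simp add: open_Times)
  \<comment> \<open>The \<open>l\<close> component of the shift direction; it is the factor of
    \<theta> in the one-dimensional map to be inverted, and fixes \<open>q\<close>.\<close>
  define a where "a x = l \<bullet> p x" for x
  define q where "q x = 1 + (a x)\<^sup>2" for x
  have q: "q x > 0" for x by (simp add: q_def add_pos_nonneg)
  define H where "H x s = s + theta (q x) (l \<bullet> s) *\<^sub>R p x" for x s
  define K where "K x t = t - theta (q x) (theta_inverse (a x) (l \<bullet> t)) *\<^sub>R p x" for x t
  have p': "smooth_on ?S (\<lambda>z. p (fst z))"
    by (rule smooth_on_compose[OF p smooth_on_bounded_linear[OF S bounded_linear_fst] S U]) auto
  have a': "smooth_on ?S (\<lambda>z. a (fst z))"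
    unfolding a_def by (rule smooth_on_compose_linear[OF S bounded_linear_inner_right p'])
  have q': "smooth_on ?S (\<lambda>z. q (fst z))"
    unfolding q_def by (rule smooth_on_add[OF S smooth_on_const[OF S] smooth_on_power2[OF S a']])
  have s: "smooth_on ?S snd" by (rule smooth_on_bounded_linear[OF S bounded_linear_snd])
  have l: "smooth_on ?S (\<lambda>z. l \<bullet> snd z)"
    by (rule smooth_on_compose_linear[OF S bounded_linear_inner_right s])
  have H_smooth: "smooth_on ?S (\<lambda>(x, s). H x s)"
    unfolding H_def split_def
    by (intro smooth_on_add[OF S s] smooth_on_scaleR[OF S] smooth_theta[OF S] q' l q p')
  have K_smooth: "smooth_on ?S (\<lambda>(x, s). K x s)"
    unfolding K_def split_def
    by (intro smooth_on_diff[OF S s] smooth_on_scaleR[OF S] smooth_theta[OF S] smooth_theta_inverse[OF S] a' q' l q p')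
  have "l \<bullet> H x s = l \<bullet> s + a x * theta (1 + (a x)\<^sup>2) (l \<bullet> s)" for x s
    by (simp add: H_def inner_add_right a_def q_def)
  then have "K x (H x s) = s" for x s
    by (simp add: K_def theta_inverse) (simp add: H_def)
  with K_smooth have inv: "deformation_inverse U H K" by (simp add: deformation_inverse_def)
  have "H x 0 = 0" for x by (simp add: H_def theta_def)
  then have def: "deformation U H" using inv H_smooth by (auto simp: deformation_def)
  have "dird (0, v) (\<lambda>(x, s). H x s) (x, 0) = v \<and>
      dird (0, u) (dird (0, v) (\<lambda>(x, s). H x s)) (x, 0) = ((l \<bullet> u) * (l \<bullet> v)) *\<^sub>R p x"
    if x: "x \<in> U" for x u v
  proof -
    \<comment> \<open>This is the derivative of \<open>theta (q x)\<close>; it vanishes at 0 with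
      slope 1, which yields the identity at first order and \<open>p x\<close> at second.\<close>
    let ?\<phi> = "\<lambda>r. r * inverse (sqrt (1 + q x * r\<^sup>2))"
    have l_deriv: "((\<lambda>s. l \<bullet> s) has_derivative (\<lambda>v. l \<bullet> v)) (at s)" for s
      by (intro has_derivative_inner_right has_derivative_ident)
    have chain: "((\<lambda>s. f (l \<bullet> s)) has_derivative (\<lambda>v. (l \<bullet> v) * D)) (at s)"
      if "(f has_real_derivative D) (at (l \<bullet> s))" for f D s
      using has_derivative_compose[OF l_deriv that[unfolded has_field_derivative_def]] by (simp add: mult.commute)
    have "((\<lambda>s. H x s) has_derivative (\<lambda>v. v + ((l \<bullet> v) * ?\<phi> (l \<bullet> s)) *\<^sub>R p x)) (at s)" for s
      unfolding H_def
      by (intro has_derivative_add has_derivative_ident has_derivative_scaleR_left chain theta_derivative q)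
    from dird_eq[OF this] dird_eq[OF slice_has_derivative[OF H_smooth x has_derivative_ident]]
    have 1: "dird (0, v) (\<lambda>(x, s). H x s) (x, s) = v + ((l \<bullet> v) * ?\<phi> (l \<bullet> s)) *\<^sub>R p x" for s v
      by simp
    have "(?\<phi> has_real_derivative 1) (at (l \<bullet> 0))"
      by (auto intro!: derivative_eq_intros)
    then have "((\<lambda>s. v + ((l \<bullet> v) * ?\<phi> (l \<bullet> s)) *\<^sub>R p x) has_derivative
        (\<lambda>u. 0 + ((l \<bullet> v) * ((l \<bullet> u) * 1)) *\<^sub>R p x)) (at 0)"
      by (intro has_derivative_add has_derivative_const has_derivative_scaleR_left has_derivative_mult_right chain)
    from dird_eq[OF this]
      dird_eq[OF slice_has_derivative[OF smooth_on_dird[OF H_smooth, of "(0, v)"] x has_derivative_ident], of u 0]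
    have "dird (0, u) (dird (0, v) (\<lambda>(x, s). H x s)) (x, 0) = ((l \<bullet> u) * (l \<bullet> v)) *\<^sub>R p x"
      by (simp add: 1 mult.commute)
    then show ?thesis using 1[of v 0] by simp
  qed
  then show ?thesis unfolding realizable_def using def inv by blast
qed

text \<open>Every coefficient in the basis expansion of \<open>Q\<close> is polarized into three
  squares of linear forms, each realizable on its own.\<close>

lemma realizable_symmetric:
  fixes U :: "(real ^ 'n::finite) set"
  assumes U: "open U" and bil: "\<And>x. x \<in> U \<Longrightarrow> bilinear (Q x)"
    and sym: "\<And>x u v. x \<in> U \<Longrightarrow> Q x u v = Q x v u"
    and smooth: "\<And>u v. smooth_on U (\<lambda>x. Q x u v)"
  shows "realizable U Q"
proof -
  let ?I = "Basis \<times> Basis :: ((real ^ 'n) \<times> (real ^ 'n)) set"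
  have half: "smooth_on U (\<lambda>x. c *\<^sub>R Q x i j)" for c i j
    by (rule smooth_on_compose_linear[OF U bounded_linear_scaleR_right smooth])
  \<comment> \<open>Half of the square of the summed form minus half of each single square: the
    symmetrized product of the two basis forms. Summed over all ordered pairs it gives the mean of
    \<open>Q x u v\<close> and \<open>Q x v u\<close>.\<close>
  define T where "T k x u v =
    (((fst k + snd k) \<bullet> u) * ((fst k + snd k) \<bullet> v)) *\<^sub>R ((1/2) *\<^sub>R Q x (fst k) (snd k))
    + ((fst k \<bullet> u) * (fst k \<bullet> v)) *\<^sub>R ((-1/2) *\<^sub>R Q x (fst k) (snd k))
    + ((snd k \<bullet> u) * (snd k \<bullet> v)) *\<^sub>R ((-1/2) *\<^sub>R Q x (fst k) (snd k))" for k x u v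
  have "realizable U (\<lambda>x u v. \<Sum>k\<in>?I. T k x u v)"
    unfolding T_def
    by (intro realizable_sum[OF U] realizable_add[OF U] realizable_rank_one[OF U] half) auto
  then show ?thesis
  proof (rule realizable_cong)
    fix x u v assume x: "x \<in> U"
    have polar: "((a + b) * (a' + b')) *\<^sub>R ((1/2) *\<^sub>R w) + (a * a') *\<^sub>R ((-1/2) *\<^sub>R w) + (b * b') *\<^sub>R ((-1/2) *\<^sub>R w)
        = (1/2) *\<^sub>R ((a * b') *\<^sub>R w + (a' * b) *\<^sub>R w)" for a a' b b' and w :: "real ^ 'n"
      unfolding scaleR_scaleR scaleR_add_left[symmetric] by (rule arg_cong[where f = "\<lambda>c. c *\<^sub>R w"]) (simp add: field_simps)
    have "T k x u v = (1/2) *\<^sub>R (((u \<bullet> fst k) * (v \<bullet> snd k)) *\<^sub>R Q x (fst k) (snd k)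
        + ((v \<bullet> fst k) * (u \<bullet> snd k)) *\<^sub>R Q x (fst k) (snd k))" for k
      unfolding T_def inner_add_left polar by (simp add: inner_commute)
    then have "(\<Sum>k\<in>?I. T k x u v) = (1/2) *\<^sub>R (Q x u v + Q x v u)"
      by (simp add: bilinear_Basis[OF bil[OF x], of u v] bilinear_Basis[OF bil[OF x], of v u]
          split_def scaleR_sum_right[symmetric] sum.distrib)
    then show "(\<Sum>k\<in>?I. T k x u v) = Q x u v"
      using sym[OF x, of v u] by (simp add: scaleR_2[symmetric])
  qed
qed

text \<open>Constant fields commute, so vanishing torsion makes the Christoffel symbols symmetric
  and hence realizable. The resulting \<open>A\<close> is the identity, so
  \<open>christoffel\<close> returns exactly these symbols.\<close>

lemma torsion_free_connection_specified:
  fixes U :: "(real ^ 'n::finite) set"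
  assumes U: "open U" and D: "affine_connection U D" and "torsion_free U D"
  shows "\<exists>H K. deformation U H \<and> deformation_inverse U H K \<and> specifies_connection U H K D"
proof -
  note c = smooth_on_const[OF U]
  have "D (\<lambda>_. u) (\<lambda>_. v) x - D (\<lambda>_. v) (\<lambda>_. u) x - lie_bracket (\<lambda>_. u) (\<lambda>_. v) x = 0"
    if "x \<in> U" for x u v
    using assms(3) c that unfolding torsion_free_def by blast
  then have sym: "D (\<lambda>_. u) (\<lambda>_. v) x = D (\<lambda>_. v) (\<lambda>_. u) x" if "x \<in> U" for x u v
    using that by (simp add: lie_bracket_dird dird_eq[OF has_derivative_const])
  have "smooth_on U (D (\<lambda>_. u) (\<lambda>_. v))" for u v
    by (rule conn_smooth[OF U D c c])
  then have "realizable U (\<lambda>x u v. D (\<lambda>_. u) (\<lambda>_. v) x)"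
    by (intro realizable_symmetric[OF U bilinear_conn_const[OF U D] sym])
  then obtain H K where HK: "deformation U H" "deformation_inverse U H K"
    and d: "\<And>x v. x \<in> U \<Longrightarrow> dird (0, v) (\<lambda>(x, s). H x s) (x, 0) = v"
      "\<And>x u v. x \<in> U \<Longrightarrow> dird (0, u) (dird (0, v) (\<lambda>(x, s). H x s)) (x, 0) = D (\<lambda>_. u) (\<lambda>_. v) x"
    unfolding realizable_def by blast
  interpret deformed U H K by (unfold_locales) (fact U HK)+
  have "A x v = v" "C x u v = D (\<lambda>_. u) (\<lambda>_. v) x" if "x \<in> U" for x u v
    using d[OF that] by (simp_all add: A_def C_def F_def)
  then have "christoffel x u v = D (\<lambda>_. u) (\<lambda>_. v) x" if "x \<in> U" for x u v
    using BA[OF that, of "C x u v"] that by (simp add: christoffel_def)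
  then have "specifies_connection U H K D" by (simp add: specifies_connection_iff[OF D])
  then show ?thesis using HK by blast
qed

theorem theorem1:
  fixes U :: "(real ^ 'n::finite) set"
  assumes "open U"
  shows
    "(\<forall>H K. deformation U H \<longrightarrow> deformation_inverse U H K \<longrightarrow>
        frame_field U (vielbein H) \<and>
        (\<forall>E. infinitesimal_action U H K E \<longleftrightarrow> (\<forall>m. \<forall>x\<in>U. E m x = vielbein H m x)) \<and>
        (\<forall>s\<in>undeformed_group U. \<forall>s'\<in>undeformed_group U. \<forall>x\<in>U. x + s x \<in> U \<longrightarrow>
           deformed_mult H K (deform H s) (deform H s') x = deform H (undeformed_mult s s') x) \<and>
        (\<forall>\<tau> N. smooth_on U \<tau> \<longrightarrow>
           (infinitesimal_transport U H K \<tau> N \<longleftrightarrow>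
             (\<forall>n. \<forall>x\<in>U. N n x = cov_deriv H (mult_fun H K) \<tau> n x))) \<and>
        (\<exists>D. specifies_connection U H K D \<and> torsion_free U D \<and>
           (\<forall>D'. specifies_connection U H K D' \<longrightarrow>
              (\<forall>Y Z. smooth_on U Y \<longrightarrow> smooth_on U Z \<longrightarrow> (\<forall>x\<in>U. D' Y Z x = D Y Z x))) \<and>
           (\<forall>x\<in>U. \<forall>k l. lie_bracket (vielbein H k) (vielbein H l) x
              = (\<Sum>m\<in>UNIV. structure_fun (mult_fun H K) x m k l *\<^sub>R vielbein H m x)) \<and>
           (\<forall>x\<in>U. \<forall>n k. D (vielbein H n) (vielbein H k) x
              = (\<Sum>m\<in>UNIV. gamma_coeff (mult_fun H K) x m n k *\<^sub>R vielbein H m x)) \<and>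
           (\<forall>x\<in>U. \<forall>l k n. curvature D (vielbein H k) (vielbein H n) (vielbein H l) x
              = (\<Sum>m\<in>UNIV. left_curvature (mult_fun H K) x m l k n *\<^sub>R vielbein H m x))))
     \<and>
     (\<forall>D. affine_connection U D \<longrightarrow> torsion_free U D \<longrightarrow>
        (\<exists>H K. deformation U H \<and> deformation_inverse U H K \<and> specifies_connection U H K D))"
proof (intro conjI allI impI)
  fix H K assume "deformation U H" "deformation_inverse U H K"
  then interpret deformed U H K using assms by unfold_locales
  show "frame_field U (vielbein H)" by (rule frame_field_vielbein)
  show "infinitesimal_action U H K E \<longleftrightarrow> (\<forall>m. \<forall>x\<in>U. E m x = vielbein H m x)" for E
    by (rule infinitesimal_action_iff)
  show "\<forall>s\<in>undeformed_group U. \<forall>s'\<in>undeformed_group U. \<forall>x\<in>U. x + s x \<in> U \<longrightarrow>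
      deformed_mult H K (deform H s) (deform H s') x = deform H (undeformed_mult s s') x"
    using deformed_mult_deform by blast
  show "infinitesimal_transport U H K \<tau> N \<longleftrightarrow> (\<forall>n. \<forall>x\<in>U. N n x = cov_deriv H \<phi> \<tau> n x)"
    if "smooth_on U \<tau>" for \<tau> N
    by (rule infinitesimal_transport_iff[OF that])
  show "\<exists>D. specifies_connection U H K D \<and> torsion_free U D \<and>
      (\<forall>D'. specifies_connection U H K D' \<longrightarrow>
        (\<forall>Y Z. smooth_on U Y \<longrightarrow> smooth_on U Z \<longrightarrow> (\<forall>x\<in>U. D' Y Z x = D Y Z x))) \<and>
      (\<forall>x\<in>U. \<forall>k l. lie_bracket (vielbein H k) (vielbein H l) x
        = (\<Sum>m\<in>UNIV. structure_fun \<phi> x m k l *\<^sub>R vielbein H m x)) \<and>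
      (\<forall>x\<in>U. \<forall>n k. D (vielbein H n) (vielbein H k) x
        = (\<Sum>m\<in>UNIV. gamma_coeff \<phi> x m n k *\<^sub>R vielbein H m x)) \<and>
      (\<forall>x\<in>U. \<forall>l k n. curvature D (vielbein H k) (vielbein H n) (vielbein H l) x
        = (\<Sum>m\<in>UNIV. left_curvature \<phi> x m l k n *\<^sub>R vielbein H m x))"
    \<comment> \<open>The witness is the connection with Christoffel field
      \<open>christoffel\<close>.\<close>
    by (intro exI[of _ conn] conjI allI impI ballI specifies_conn torsion_free_conn
        specifies_connection_unique lie_bracket_vielbein conn_vielbein curvature_vielbein)
next
  show "\<exists>H K. deformation U H \<and> deformation_inverse U H K \<and> specifies_connection U H K D"
    if "affine_connection U D" "torsion_free U D" for D
    by (rule torsion_free_connection_specified[OF assms that])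
qed

end
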